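(* For any constant $\gamma>0$, with probability $1-O(T^{-\gamma})$, the regret of the hierarchical baseline algorithm described in the context, run with parameters $T_0<T_1<\dots<T_k=T$, $n$, $m$, is $$\tilde O\!\left(\frac{T_k}{m}+\frac{T_k}{\sqrt{T_{k-1}}}+\frac{n}{m}\sum_{i=0}^{k-1}\frac{T_i}{\sqrt{T_{i-1}}}\right),$$ where $T_{-1}:=1$ and $\tilde O$ hides logarithmic factors in $T$.
   Context: Setting: online experts problem with $n$ experts over $T$ days, losses $\ell_t\in[0,1]^n$ fixed in advance by an oblivious adversary (independently of the algorithm's randomness); the algorithm picks an expert $i_t$ each day; regret is $\sum_t\ell_t(i_t)-\min_{i\in[n]}\sum_t\ell_t(i)$. $n$ and $T$ are polynomially related. Hierarchical baseline algorithm. Inputs: integers $T_0<T_1<\dots<T_k=T$ with $T_{i-1}\mid T_i$ for $i\in[k]$, $n$, and a space parameter $m$; set $\epsilon=\log(T)/m$. The algorithm keeps buckets $B_0,\dots,B_{k-1}$; each is a multiset of entries (expert, arrival time, loss accumulated since arrival, weight). An entry $e'$ $\epsilon$-dominates an entry $e$ if $e'$ has an earlier arrival time than $e$ and the accumulated loss of $e'$ (since its own arrival) is at most $(1+\epsilon)$ times the accumulated loss of $e$ (since its own arrival). Predictions: on each day, for each level $i$, an entry $e_i$ of $B_i$ is drawn with probability proportional to its weight (multiplicative weights (MWU) over $B_i$ with learning rate $\sqrt{\log(|B_i|)/T_i}$, weights reset every $T_i$ days at bucket updates). Set $y_0=e_0$ and for $i\ge1$ choose $y_i$ between $e_i$ and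 $y_{i-1}$ by a two-option MWU (learning rate $\sqrt{2/T_i}$, restarted every $T_i$ days); play $y_{k-1}$. Each day the losses of all entries in all buckets are observed, accumulated losses are incremented, and all MWU weights updated. Bucket updates at each $t$ that is a multiple of $T_0$ (and at $t=0$): let $k'$ be the largest $i\in\{0,\dots,k-1\}$ with $T_i\mid t$, and $\tau$ the largest multiple of $T_{k'+1}$ that is $\le t$. (1) Eviction: for each $i\le k'$, remove from $B_i$ every entry with arrival time at least $\tau+0.5$ that is $\epsilon$-dominated by some entry of $B_i$; reset remaining weights in $B_i$ and the level-$i$ between-level weights to $1$. (2) Forwarding: for $i=k',\dots,1$, add to $B_i$ copies of all entries of $B_0,\dots,B_{i-1}$ with distinct arrival times in $[t,t+0.5)$, loss $0$, weight $1$. (3) Sampling: for each $i\le k'$, sample $m$ experts uniformly with replacement from $[n]$ and add them to $B_i$ with distinct arrival times in $[t+0.5,t+1)$, loss $0$, weight $1$.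
   Formalization: The space parameter m is additionally assumed to be at most polynomial in T (m ≤ T^c for an arbitrary constant c); for m exponentially large the learning rates blow up, MWU becomes follow-the-leader, and the stated bound fails. *)

theory Defs
  imports "HOL-Probability.Probability"
begin

text \<open>
  Conventions. Experts are \<open>0, \<dots>, n - 1\<close> and days are \<open>0, \<dots>, T - 1\<close>; \<open>l t x\<close> is the loss of
  expert \<open>x\<close> on day \<open>t\<close>. The loss table \<open>l\<close> is a fixed function (oblivious adversary). A bucket
  update ``at \<open>t\<close>'' takes place before the prediction of day \<open>t\<close>. Logarithms are natural.
\<close>

record entry =
  expert :: nat
  arrival :: real
  loss :: real
  weight :: real

text \<open>
  A bucket is a list of entries standing for a multiset: nothing depends on the list order except
  which of the new arrival times an added entry receives, and that assignment is arbitrary (see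
  \<open>arrival_scheme\<close> below). For level \<open>i \<ge> 1\<close>, \<open>own_wt i\<close> and \<open>below_wt i\<close> are the weights of the two
  options (the entry drawn from bucket \<open>i\<close>, and the choice of level \<open>i - 1\<close>) between which level \<open>i\<close>
  decides. \<open>played\<close> lists the experts played so far.
\<close>

record hstate =
  bucket :: "nat \<Rightarrow> entry list"
  own_wt :: "nat \<Rightarrow> real"
  below_wt :: "nat \<Rightarrow> real"
  played :: "nat list"

definition time_scales :: "nat \<Rightarrow> (nat \<Rightarrow> nat) \<Rightarrow> nat \<Rightarrow> bool" where
  "time_scales k Ts T \<longleftrightarrow>
     0 < k \<and> 0 < Ts 0 \<and> Ts k = T \<and> (\<forall>i<k. Ts i < Ts (Suc i) \<and> Ts i dvd Ts (Suc i))"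

definition prev_scale :: "(nat \<Rightarrow> nat) \<Rightarrow> nat \<Rightarrow> nat" where
  "prev_scale Ts i = (if i = 0 then 1 else Ts (i - 1))"

text \<open>
  The algorithm only asks for distinct arrival times in the given intervals. \<open>fwd t i N j\<close> is the
  time given to the \<open>j\<close>-th of the \<open>N\<close> entries forwarded to bucket \<open>i\<close> at \<open>t\<close>, and \<open>smp t i j\<close> the time
  of the \<open>j\<close>-th of the \<open>m\<close> experts sampled into it; any such choice is allowed.
\<close>

definition arrival_scheme ::
  "nat \<Rightarrow> (nat \<Rightarrow> nat \<Rightarrow> nat \<Rightarrow> nat \<Rightarrow> real) \<Rightarrow> (nat \<Rightarrow> nat \<Rightarrow> nat \<Rightarrow> real) \<Rightarrow> bool" where
  "arrival_scheme m fwd smp \<longleftrightarrow>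
     (\<forall>t i N. inj_on (fwd t i N) {..<N} \<and> fwd t i N ` {..<N} \<subseteq> {real t..<real t + 1/2}) \<and>
     (\<forall>t i. inj_on (smp t i) {..<m} \<and> smp t i ` {..<m} \<subseteq> {real t + 1/2..<real t + 1})"


subsection \<open>Bucket updates\<close>

definition update_level :: "nat \<Rightarrow> (nat \<Rightarrow> nat) \<Rightarrow> nat \<Rightarrow> nat" where
  "update_level k Ts t = Max {i. i < k \<and> Ts i dvd t}"

definition epoch_start :: "nat \<Rightarrow> (nat \<Rightarrow> nat) \<Rightarrow> nat \<Rightarrow> nat" where
  "epoch_start k Ts t =
     (let S = Ts (Suc (update_level k Ts t)) in S * (t div S))"

definition dominates :: "real \<Rightarrow> entry \<Rightarrow> entry \<Rightarrow> bool" where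
  "dominates \<epsilon> e' e \<longleftrightarrow> arrival e' < arrival e \<and> loss e' \<le> (1 + \<epsilon>) * loss e"

definition evict :: "real \<Rightarrow> nat \<Rightarrow> entry list \<Rightarrow> entry list" where
  "evict \<epsilon> \<tau> B =
     filter (\<lambda>e. \<not> (real \<tau> + 1/2 \<le> arrival e \<and> (\<exists>e'\<in>set B. dominates \<epsilon> e' e))) B"

definition new_entries :: "(nat \<Rightarrow> real) \<Rightarrow> nat list \<Rightarrow> entry list" where
  "new_entries a xs =
     map (\<lambda>j. \<lparr>expert = xs ! j, arrival = a j, loss = 0, weight = 1\<rparr>) [0..<length xs]"

definition evict_step ::
  "real \<Rightarrow> nat \<Rightarrow> nat \<Rightarrow> (nat \<Rightarrow> entry list) \<Rightarrow> nat \<Rightarrow> entry list" where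
  "evict_step \<epsilon> k' \<tau> B i =
     (if i \<le> k' then map (\<lambda>e. e\<lparr>weight := 1\<rparr>) (evict \<epsilon> \<tau> (B i)) else B i)"

text \<open>
  All levels are forwarded simultaneously from the old buckets. This is what the descending order
  \<open>i = k', \<dots>, 1\<close> achieves; for \<open>i = 0\<close> nothing is added.
\<close>

definition forward_step ::
  "(nat \<Rightarrow> nat \<Rightarrow> nat \<Rightarrow> nat \<Rightarrow> real) \<Rightarrow> nat \<Rightarrow> nat \<Rightarrow> (nat \<Rightarrow> entry list) \<Rightarrow> nat \<Rightarrow> entry list" where
  "forward_step fwd k' t B i =
     (if i \<le> k'
      then B i @ (let xs = map expert (concat (map B [0..<i]))
                  in new_entries (fwd t i (length xs)) xs)
      else B i)"

definition sample_step ::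
  "(nat \<Rightarrow> nat \<Rightarrow> nat \<Rightarrow> real) \<Rightarrow> nat \<Rightarrow> nat \<Rightarrow> (nat \<Rightarrow> nat list) \<Rightarrow> (nat \<Rightarrow> entry list) \<Rightarrow>
   nat \<Rightarrow> entry list" where
  "sample_step smp k' t X B i = (if i \<le> k' then B i @ new_entries (smp t i) (X i) else B i)"

definition update_buckets ::
  "nat \<Rightarrow> (nat \<Rightarrow> nat) \<Rightarrow> nat \<Rightarrow> nat \<Rightarrow> (nat \<Rightarrow> nat \<Rightarrow> nat \<Rightarrow> nat \<Rightarrow> real) \<Rightarrow>
   (nat \<Rightarrow> nat \<Rightarrow> nat \<Rightarrow> real) \<Rightarrow> nat \<Rightarrow> hstate \<Rightarrow> hstate pmf" where
  "update_buckets k Ts n m fwd smp t s =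
     (let \<epsilon> = ln (real (Ts k)) / real m;
          k' = update_level k Ts t;
          \<tau> = epoch_start k Ts t;
          B = forward_step fwd k' t (evict_step \<epsilon> k' \<tau> (bucket s))
      in map_pmf
           (\<lambda>X. s\<lparr>bucket := sample_step smp k' t X B,
                  own_wt := (\<lambda>i. if i \<le> k' then 1 else own_wt s i),
                  below_wt := (\<lambda>i. if i \<le> k' then 1 else below_wt s i)\<rparr>)
           (Pi_pmf {..k'} [] (\<lambda>_. replicate_pmf m (pmf_of_set {..<n}))))"


subsection \<open>Predictions\<close>

definition draw_expert :: "entry list \<Rightarrow> nat pmf" where
  "draw_expert B =
     map_pmf expert (pmf_of_list (map (\<lambda>e. (e, weight e / (\<Sum>e'\<leftarrow>B. weight e'))) B))"

definition draws :: "nat \<Rightarrow> hstate \<Rightarrow> (nat \<Rightarrow> nat) pmf" where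
  "draws k s = Pi_pmf {..<k} 0 (\<lambda>i. draw_expert (bucket s i))"

definition coins :: "nat \<Rightarrow> hstate \<Rightarrow> (nat \<Rightarrow> bool) pmf" where
  "coins k s =
     Pi_pmf {1..<k} False (\<lambda>i. bernoulli_pmf (own_wt s i / (own_wt s i + below_wt s i)))"

primrec choice :: "(nat \<Rightarrow> nat) \<Rightarrow> (nat \<Rightarrow> bool) \<Rightarrow> nat \<Rightarrow> nat" where
  "choice e c 0 = e 0"
| "choice e c (Suc i) = (if c (Suc i) then e (Suc i) else choice e c i)"

text \<open>
  MWU is run in its exponential form: a loss \<open>x\<close> multiplies a weight by \<open>exp (- \<eta> * x)\<close>. The losses
  of the two options of level \<open>i\<close> are those of the experts \<open>e i\<close> and \<open>choice e c (i - 1)\<close> actually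
  drawn on that day. The two weights stored at level \<open>0\<close> are never used.
\<close>

definition observe ::
  "nat \<Rightarrow> (nat \<Rightarrow> nat) \<Rightarrow> (nat \<Rightarrow> real) \<Rightarrow> (nat \<Rightarrow> nat) \<Rightarrow> (nat \<Rightarrow> bool) \<Rightarrow> hstate \<Rightarrow> hstate" where
  "observe k Ts lt e c s =
     s\<lparr>bucket := (\<lambda>i.
         let \<eta> = sqrt (ln (real (length (bucket s i))) / real (Ts i))
         in map (\<lambda>E. E\<lparr>loss := loss E + lt (expert E),
                        weight := weight E * exp (- \<eta> * lt (expert E))\<rparr>) (bucket s i)),
       own_wt := (\<lambda>i. own_wt s i * exp (- sqrt (2 / real (Ts i)) * lt (e i))),
       below_wt := (\<lambda>i. below_wt s i * exp (- sqrt (2 / real (Ts i)) * lt (choice e c (i - 1)))),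
       played := played s @ [choice e c (k - 1)]\<rparr>"

definition predict_day ::
  "nat \<Rightarrow> (nat \<Rightarrow> nat) \<Rightarrow> (nat \<Rightarrow> real) \<Rightarrow> hstate \<Rightarrow> hstate pmf" where
  "predict_day k Ts lt s =
     bind_pmf (draws k s) (\<lambda>e. map_pmf (\<lambda>c. observe k Ts lt e c s) (coins k s))"

definition init_state :: hstate where
  "init_state = \<lparr>bucket = (\<lambda>_. []), own_wt = (\<lambda>_. 1), below_wt = (\<lambda>_. 1), played = []\<rparr>"

text \<open>\<open>hier_run \<dots> d\<close> is the distribution of the state after the first \<open>d\<close> days.\<close>

primrec hier_run ::
  "nat \<Rightarrow> (nat \<Rightarrow> nat) \<Rightarrow> nat \<Rightarrow> nat \<Rightarrow> (nat \<Rightarrow> nat \<Rightarrow> nat \<Rightarrow> nat \<Rightarrow> real) \<Rightarrow>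
   (nat \<Rightarrow> nat \<Rightarrow> nat \<Rightarrow> real) \<Rightarrow> (nat \<Rightarrow> nat \<Rightarrow> real) \<Rightarrow> nat \<Rightarrow> hstate pmf" where
  "hier_run k Ts n m fwd smp l 0 = return_pmf init_state"
| "hier_run k Ts n m fwd smp l (Suc t) =
     bind_pmf (hier_run k Ts n m fwd smp l t) (\<lambda>s.
     bind_pmf (if Ts 0 dvd t then update_buckets k Ts n m fwd smp t s else return_pmf s)
       (predict_day k Ts (l t)))"

definition regret :: "(nat \<Rightarrow> nat \<Rightarrow> real) \<Rightarrow> nat \<Rightarrow> nat \<Rightarrow> nat list \<Rightarrow> real" where
  "regret l T n xs = (\<Sum>t<T. l t (xs ! t)) - Min ((\<lambda>x. \<Sum>t<T. l t x) ` {..<n})"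

end

theory Submission
  imports Defs
begin

text \<open>
  Fix a best expert \<open>x\<close>. Whether a copy of \<open>x\<close> put into a sample slot of bucket \<open>i\<close> would stay there
  until the end depends only on entries with earlier arrival times, hence not on the expert that is
  actually sampled into the slot. So each slot in which \<open>x\<close> would survive receives \<open>x\<close> with
  probability \<open>1 / n\<close>, independently of this condition, and with high probability \<open>x\<close> is captured
  after \<open>O(n log T)\<close> such slots. Hence at most \<open>O((n / m) log T)\<close> update times of level \<open>i\<close> are bad:
  all their \<open>m\<close> slots let \<open>x\<close> survive and none of them, nor an earlier one, has captured \<open>x\<close>.

  From a time that is not bad for level \<open>i\<close> one can jump to a later time \<open>t'\<close> such that bucket \<open>i\<close>
  contains, all the way, an entry whose loss is at most \<open>1 + \<epsilon>\<close> times that of \<open>x\<close>. Forwarding copies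
  that entry to the higher buckets, and the epoch condition of the eviction rule makes \<open>t'\<close> compatible
  with the higher levels. Jumping from the highest level that is not bad, one pays the regret
  \<open>O(sqrt T_i)\<close> of multiplicative weights on an interval of level \<open>i\<close> only inside intervals of level
  \<open>i + 1\<close> that start at a bad time, that is, \<open>O((n / m) T_(i+1) / T_i)\<close> times up to logarithms.
\<close>

subsection \<open>Exponential weights and exponential supermartingales\<close>

text \<open>The samples steer the buckets, and the draws and coins of lower levels feed the
  two-option weights above them, so the sources of randomness cannot be treated as independent. One
  device controls all of them: products of daily factors with conditional mean at most 1, combined
  with Markov's inequality. Outside an event built from such products the regret bound is a
  deterministic statement about the path.

  The day of capture is random, and a capture turns the product of the misses into 0. In place of a
  stopping time, the product is cut off at each fixed day, and the union bound runs over the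
  cut-offs as well. This leads to the deviation parameter \<open>(\<gamma> + 2) * ln T\<close>.

  Bucket sizes enter only through the square root of their logarithm. Counting additions gives at
  most \<open>m * T ^ k\<close> entries with \<open>k = O(ln T)\<close>, so eviction is not
  exploited for the size. One logarithm of the final bound comes from the resulting rate, the other
  from the number of bad times.\<close>

lemma exp_le_quadratic:
  fixes x :: real
  assumes "x \<le> 1"
  shows "exp x \<le> 1 + x + x\<^sup>2"
proof (cases "0 \<le> x")
  case True
  then show ?thesis using assms by (rule exp_bound)
next
  case False
  define y where "y = - x"
  have y: "0 < y" using False by (simp add: y_def)
  \<comment> \<open>The product equals \<open>1 + y ^ 3\<close>.\<close>
  have "1 \<le> (1 + y) * (1 - y + y\<^sup>2)"
    using y by (simp add: algebra_simps power2_eq_square)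
  also have "\<dots> \<le> exp y * (1 - y + y\<^sup>2)"
  proof (rule mult_right_mono)
    have "1 - y + y\<^sup>2 = (1 - y / 2)\<^sup>2 + 3 / 4 * y\<^sup>2"
      by (simp add: power2_eq_square algebra_simps)
    also have "\<dots> \<ge> 0" by simp
    finally show "0 \<le> 1 - y + y\<^sup>2" .
  qed (use exp_ge_add_one_self[of y] in simp)
  finally have "1 / exp y \<le> 1 - y + y\<^sup>2" by (simp add: field_simps)
  then show ?thesis by (simp add: y_def exp_minus inverse_eq_divide)
qed

text \<open>Serves both signs of \<open>r\<close>: \<open>r = - \<eta>\<close> bounds the potential
  of the weights, and positive \<open>r\<close> the moment generating function of a random choice.
  The quadratic bound only asks for \<open>r * v b \<le> 1\<close>.\<close>

lemma weighted_sum_exp_le: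
  fixes w v :: "'a \<Rightarrow> real" and r :: real
  assumes fin: "finite I"
    and w: "\<And>b. b \<in> I \<Longrightarrow> 0 \<le> w b" and W: "0 < sum w I"
    and v: "\<And>b. b \<in> I \<Longrightarrow> 0 \<le> v b \<and> v b \<le> 1" and r: "r \<le> 1"
  shows "(\<Sum>b\<in>I. w b * exp (r * v b))
           \<le> sum w I * exp (r * ((\<Sum>b\<in>I. w b * v b) / sum w I) + r\<^sup>2)"
proof -
  have "(\<Sum>b\<in>I. w b * exp (r * v b)) \<le> (\<Sum>b\<in>I. w b * (1 + r * v b + r\<^sup>2))"
  proof (intro sum_mono mult_left_mono w)
    fix b assume b: "b \<in> I"
    have "r * v b \<le> 1"
    proof (cases "0 \<le> r")
      case True
      then show ?thesis using mult_mono[of r 1 "v b" 1] v[OF b] r by simp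
    next
      case False
      then have "r * v b \<le> 0" using v[OF b] by (simp add: mult_nonpos_nonneg)
      then show ?thesis by simp
    qed
    then have "exp (r * v b) \<le> 1 + r * v b + (r * v b)\<^sup>2" by (rule exp_le_quadratic)
    also have "(r * v b)\<^sup>2 \<le> r\<^sup>2"
      using v[OF b] by (simp add: power_mult_distrib mult_left_le power_le_one)
    finally show "exp (r * v b) \<le> 1 + r * v b + r\<^sup>2" by simp
  qed
  also have "\<dots> = sum w I * (1 + (r * ((\<Sum>b\<in>I. w b * v b) / sum w I) + r\<^sup>2))"
  proof -
    have "(\<Sum>b\<in>I. w b * (1 + r * v b + r\<^sup>2))
        = sum w I + r * (\<Sum>b\<in>I. w b * v b) + r\<^sup>2 * sum w I"
      by (simp add: ring_distribs sum.distrib sum_distrib_left sum_distrib_right mult_ac)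
    then show ?thesis using W by (simp add: field_simps)
  qed
  also have "\<dots> \<le> sum w I * exp (r * ((\<Sum>b\<in>I. w b * v b) / sum w I) + r\<^sup>2)"
    using W by (intro mult_left_mono exp_ge_add_one_self) auto
  finally show ?thesis .
qed

text \<open>The total weight falls at least as fast as the mean losses dictate, and it never falls
  below the weight of \<open>a\<close>. The inequality stays multiplied by \<open>\<eta>\<close>,
  which may be 0. Rates above 1 are covered; they occur when the logarithm of the bucket size
  exceeds the interval length.\<close>

lemma exponential_weights_regret:
  fixes v :: "'a \<Rightarrow> nat \<Rightarrow> real" and \<eta> :: real
  defines "w \<equiv> (\<lambda>s b. exp (- \<eta> * (\<Sum>r<s. v b r)))"
  assumes fin: "finite I" and a: "a \<in> I" and \<eta>: "0 \<le> \<eta>"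
    and v: "\<And>b s. b \<in> I \<Longrightarrow> s < N \<Longrightarrow> 0 \<le> v b s \<and> v b s \<le> 1"
  shows "\<eta> * (\<Sum>s<N. (\<Sum>b\<in>I. w s b * v b s) / sum (w s) I)
           \<le> \<eta> * (\<Sum>s<N. v a s) + ln (real (card I)) + \<eta>\<^sup>2 * real N"
proof -
  define p where "p = (\<lambda>s. (\<Sum>b\<in>I. w s b * v b s) / sum (w s) I)"
  have pos: "0 < sum (w s) I" for s
    using fin a by (intro sum_pos) (auto simp: w_def)
  have "M \<le> N \<Longrightarrow> sum (w M) I \<le> real (card I) * exp (- \<eta> * (\<Sum>s<M. p s) + \<eta>\<^sup>2 * real M)" for M
  proof (induction M)
    case 0
    then show ?case by (simp add: w_def)
  next
    case (Suc M)
    have "sum (w (Suc M)) I = (\<Sum>b\<in>I. w M b * exp (- \<eta> * v b M))"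
      unfolding w_def by (intro sum.cong) (auto simp: algebra_simps simp flip: exp_add)
    also have "\<dots> \<le> sum (w M) I * exp (- \<eta> * p M + (- \<eta>)\<^sup>2)"
      unfolding p_def
      by (rule weighted_sum_exp_le) (use fin v Suc.prems \<eta> pos in \<open>auto simp: w_def\<close>)
    also have "\<dots> \<le> real (card I) * exp (- \<eta> * (\<Sum>s<M. p s) + \<eta>\<^sup>2 * real M)
                    * exp (- \<eta> * p M + (- \<eta>)\<^sup>2)"
      using Suc by (intro mult_right_mono) auto
    also have "\<dots> = real (card I) * exp (- \<eta> * (\<Sum>s<Suc M. p s) + \<eta>\<^sup>2 * real (Suc M))"
      by (simp add: algebra_simps flip: exp_add)
    finally show ?case .
  qed
  from this[of N] have N: "sum (w N) I \<le> real (card I) * exp (- \<eta> * (\<Sum>s<N. p s) + \<eta>\<^sup>2 * real N)"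
    by simp
  have card: "0 < real (card I)" using fin a by (auto simp: card_gt_0_iff)
  have "w N a \<le> sum (w N) I" using fin a by (intro member_le_sum) (auto simp: w_def)
  with N have "w N a \<le> real (card I) * exp (- \<eta> * (\<Sum>s<N. p s) + \<eta>\<^sup>2 * real N)" by linarith
  then have "ln (w N a) \<le> ln (real (card I) * exp (- \<eta> * (\<Sum>s<N. p s) + \<eta>\<^sup>2 * real N))"
    using card by (subst ln_le_cancel_iff) (auto simp: w_def)
  then have "- \<eta> * (\<Sum>s<N. v a s) \<le> ln (real (card I)) + (- \<eta> * (\<Sum>s<N. p s) + \<eta>\<^sup>2 * real N)"
    using card by (simp add: w_def ln_mult)
  then show ?thesis by (simp add: p_def algebra_simps)
qed

text \<open>The case of a single option, in which the tuned learning rate vanishes, is exact.\<close>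

lemma tuned_exponential_weights_regret:
  fixes v :: "'a \<Rightarrow> nat \<Rightarrow> real"
  assumes fin: "finite I" and a: "a \<in> I"
    and v: "\<And>b s. b \<in> I \<Longrightarrow> s < N \<Longrightarrow> 0 \<le> v b s \<and> v b s \<le> 1"
  defines "\<eta> \<equiv> sqrt (ln (real (card I)) / real N)"
  defines "w \<equiv> (\<lambda>s b. exp (- \<eta> * (\<Sum>r<s. v b r)))"
  shows "(\<Sum>s<N. (\<Sum>b\<in>I. w s b * v b s) / sum (w s) I)
           \<le> (\<Sum>s<N. v a s) + 2 * sqrt (real N * ln (real (card I)))"
proof (cases "N = 0 \<or> card I = 1")
  case True
  show ?thesis
  proof (cases "N = 0")
    case False
    with True obtain b where "I = {b}" by (auto simp: card_1_singleton_iff)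
    with a have "I = {a}" by auto
    then show ?thesis by (auto simp: w_def)
  qed auto
next
  case False
  then have N: "0 < real N" by simp
  have "card I \<noteq> 0" using fin a by auto
  with False have card: "1 < real (card I)" by linarith
  then have ln: "0 < ln (real (card I))" by simp
  then have \<eta>: "0 < \<eta>" using N by (simp add: \<eta>_def)
  \<comment> \<open>The two error terms, divided by \<open>\<eta>\<close>, are thus both
    \<open>sqrt (N * ln (card I))\<close>, whence the factor 2.\<close>
  have sq: "\<eta>\<^sup>2 * real N = ln (real (card I))" using ln N by (simp add: \<eta>_def)
  have prod: "\<eta> * sqrt (real N * ln (real (card I))) = ln (real (card I))"
    using N ln by (simp add: \<eta>_def flip: real_sqrt_mult)
  have "\<eta> * (\<Sum>s<N. (\<Sum>b\<in>I. w s b * v b s) / sum (w s) I)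
          \<le> \<eta> * (\<Sum>s<N. v a s) + ln (real (card I)) + \<eta>\<^sup>2 * real N"
    unfolding w_def by (rule exponential_weights_regret) (use fin a v \<eta> in auto)
  also have "\<dots> = \<eta> * ((\<Sum>s<N. v a s) + 2 * sqrt (real N * ln (real (card I))))"
    using prod sq by (simp add: ring_distribs mult.left_commute)
  finally show ?thesis using \<eta> by simp
qed

section \<open>Products of factors along a random path\<close>

primrec path_pmf :: "(nat \<Rightarrow> (nat \<Rightarrow> 'a) \<Rightarrow> 'a pmf) \<Rightarrow> nat \<Rightarrow> (nat \<Rightarrow> 'a) pmf" where
  "path_pmf K 0 = return_pmf (\<lambda>_. undefined)"
| "path_pmf K (Suc t) = bind_pmf (path_pmf K t) (\<lambda>w. map_pmf (\<lambda>x. w(t := x)) (K t w))"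

text \<open>The partial products form a supermartingale: the last day is integrated first, and by
  adaptedness the earlier factors are constants for it. The bound on a factor is asked on reachable
  paths only, since positivity of weights and the like are known just there.\<close>

lemma nn_integral_path_pmf_prod_le_1:
  fixes H :: "nat \<Rightarrow> (nat \<Rightarrow> 'a) \<Rightarrow> real"
  assumes nonneg: "\<And>t w. 0 \<le> H t w"
    and adapted: "\<And>t r w x. t < r \<Longrightarrow> H t (w(r := x)) = H t w"
    and step: "\<And>t w. t < d \<Longrightarrow> w \<in> set_pmf (path_pmf K t) \<Longrightarrow>
                 (\<integral>\<^sup>+x. ennreal (H t (w(t := x))) \<partial>K t w) \<le> 1"
  shows "(\<integral>\<^sup>+w. ennreal (\<Prod>t<d. H t w) \<partial>path_pmf K d) \<le> 1"
  using step
proof (induction d)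
  case 0
  then show ?case by simp
next
  case (Suc d)
  have "(\<integral>\<^sup>+w. ennreal (\<Prod>t<Suc d. H t w) \<partial>path_pmf K (Suc d))
      = (\<integral>\<^sup>+w. (\<integral>\<^sup>+x. ennreal (\<Prod>t<d. H t w) * ennreal (H d (w(d := x))) \<partial>K d w) \<partial>path_pmf K d)"
    by (simp add: adapted nonneg prod_nonneg ennreal_mult)
  also have "\<dots> = (\<integral>\<^sup>+w. ennreal (\<Prod>t<d. H t w)
                     * (\<integral>\<^sup>+x. ennreal (H d (w(d := x))) \<partial>K d w) \<partial>path_pmf K d)"
    by (simp add: nn_integral_cmult)
  also have "\<dots> \<le> (\<integral>\<^sup>+w. ennreal (\<Prod>t<d. H t w) * 1 \<partial>path_pmf K d)"
    by (intro nn_integral_mono_AE AE_pmfI mult_left_mono Suc.prems) auto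
  also have "\<dots> \<le> 1" using Suc by simp
  finally show ?case .
qed

text \<open>Markov's inequality, in the form suited to exponential products.\<close>

lemma prob_ge_le_of_nn_integral_le_1:
  fixes f :: "'a \<Rightarrow> real" and b :: real
  assumes "\<And>x. 0 \<le> f x" and "(\<integral>\<^sup>+x. ennreal (f x) \<partial>measure_pmf p) \<le> 1"
  shows "measure_pmf.prob p {x. exp b \<le> f x} \<le> exp (- b)"
proof -
  have "emeasure (measure_pmf p) {x. exp b \<le> f x}
      = (\<integral>\<^sup>+x. indicator {x. exp b \<le> f x} x \<partial>measure_pmf p)" by simp
  also have "\<dots> \<le> (\<integral>\<^sup>+x. ennreal (exp (- b)) * ennreal (f x) \<partial>measure_pmf p)"
  proof (rule nn_integral_mono)
    fix x
    have "exp b \<le> f x \<Longrightarrow> 1 \<le> exp (- b) * f x"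
      by (simp add: exp_minus field_simps)
    then show "indicator {x. exp b \<le> f x} x \<le> ennreal (exp (- b)) * ennreal (f x)"
      using assms(1)[of x] by (auto simp: indicator_def simp flip: ennreal_mult intro: ennreal_leI)
  qed
  also have "\<dots> = ennreal (exp (- b)) * (\<integral>\<^sup>+x. ennreal (f x) \<partial>measure_pmf p)"
    by (simp add: nn_integral_cmult)
  also have "\<dots> \<le> ennreal (exp (- b)) * 1"
    by (intro mult_left_mono assms) auto
  finally show ?thesis by (simp add: measure_pmf.emeasure_eq_measure)
qed

section \<open>Sampled lists and weighted lists as distributions\<close>

text \<open>The algorithm samples a list in slot order, whereas the capture argument reveals the
  slots by arrival time. An independent family indexed by the slots allows any order.\<close>

lemma replicate_pmf_conv_Pi_pmf:
  "replicate_pmf m p = map_pmf (\<lambda>f. map f [0..<m]) (Pi_pmf {..<m} d (\<lambda>_. p))"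
proof (induction m)
  case 0
  then show ?case by simp
next
  case (Suc m)
  have "replicate_pmf (Suc m) p =
          bind_pmf (replicate_pmf m p) (\<lambda>xs. map_pmf (\<lambda>y. xs @ [y]) p)"
    using replicate_pmf_distrib[of m 1 p]
    by (simp add: map_pmf_def bind_assoc_pmf bind_return_pmf)
  also have "\<dots> = bind_pmf p (\<lambda>y. bind_pmf (Pi_pmf {..<m} d (\<lambda>_. p))
                    (\<lambda>f. return_pmf (map f [0..<m] @ [y])))"
    unfolding Suc map_pmf_def by (subst bind_commute_pmf) (simp add: bind_assoc_pmf bind_return_pmf)
  also have "\<dots> = map_pmf (\<lambda>f. map f [0..<Suc m]) (Pi_pmf {..<Suc m} d (\<lambda>_. p))"
    by (simp add: lessThan_Suc Pi_pmf_insert' map_pmf_def bind_assoc_pmf bind_return_pmf)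
  finally show ?case .
qed

lemma nn_integral_pmf_of_list:
  fixes f :: "'a \<Rightarrow> real"
  assumes wf: "pmf_of_list_wf xs" and f: "\<And>x. 0 \<le> f x"
  shows "(\<integral>\<^sup>+x. ennreal (f x) \<partial>pmf_of_list xs) = ennreal (\<Sum>z\<leftarrow>xs. f (fst z) * snd z)"
proof -
  \<comment> \<open>A list may name a point several times, so the mass of a point is a filtered sum.
    A fixed superset \<open>A\<close> of the points lets the induction remove one list element at a
    time.\<close>
  have *: "(\<Sum>x\<in>A. f x * (\<Sum>z\<leftarrow>filter (\<lambda>z. fst z = x) ys. snd z)) = (\<Sum>z\<leftarrow>ys. f (fst z) * snd z)"
    if "finite A" "fst ` set ys \<subseteq> A" for A ys
    using that
  proof (induction ys)
    case (Cons y ys)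
    have "(\<Sum>x\<in>A. f x * (\<Sum>z\<leftarrow>filter (\<lambda>z. fst z = x) (y # ys). snd z))
        = (\<Sum>x\<in>A. (if x = fst y then f x * snd y else 0)
              + f x * (\<Sum>z\<leftarrow>filter (\<lambda>z. fst z = x) ys. snd z))"
      by (intro sum.cong) (auto simp: algebra_simps)
    also have "\<dots> = f (fst y) * snd y + (\<Sum>z\<leftarrow>ys. f (fst z) * snd z)"
      using Cons by (simp add: sum.distrib)
    finally show ?case by simp
  qed simp
  have "(\<integral>\<^sup>+x. ennreal (f x) \<partial>pmf_of_list xs)
      = (\<Sum>x\<in>set (map fst xs). ennreal (f x) * ennreal (pmf (pmf_of_list xs) x))"
    using set_pmf_of_list[OF wf] by (intro nn_integral_measure_pmf_support) auto
  also have "\<dots> = ennreal (\<Sum>x\<in>set (map fst xs). f x * pmf (pmf_of_list xs) x)"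
    using f by (simp add: sum_ennreal flip: ennreal_mult)
  also have "\<dots> = ennreal (\<Sum>z\<leftarrow>xs. f (fst z) * snd z)"
    by (subst *[symmetric, of "set (map fst xs)"]) (auto simp: pmf_pmf_of_list[OF wf])
  finally show ?thesis .
qed

subsection \<open>The run as a function of its randomness\<close>

type_synonym day_randomness = "(nat \<Rightarrow> nat list) \<times> (nat \<Rightarrow> nat) \<times> (nat \<Rightarrow> bool)"

locale hierarchy =
  fixes k :: nat and Ts :: "nat \<Rightarrow> nat" and T n m :: nat and l :: "nat \<Rightarrow> nat \<Rightarrow> real"
    and fwd :: "nat \<Rightarrow> nat \<Rightarrow> nat \<Rightarrow> nat \<Rightarrow> real" and smp :: "nat \<Rightarrow> nat \<Rightarrow> nat \<Rightarrow> real"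
  assumes time_scales: "time_scales k Ts T"
    and n_pos: "0 < n" and m_pos: "0 < m"
    and loss_bounds: "\<And>t x. t < T \<Longrightarrow> x < n \<Longrightarrow> 0 \<le> l t x \<and> l t x \<le> 1"
    and arrival_scheme: "arrival_scheme m fwd smp"
begin

lemma k_pos: "0 < k" and T_eq: "T = Ts k"
  using time_scales by (auto simp: time_scales_def)

lemma Ts_less_Suc: "i < k \<Longrightarrow> Ts i < Ts (Suc i)" and Ts_dvd_Suc: "i < k \<Longrightarrow> Ts i dvd Ts (Suc i)"
  using time_scales by (auto simp: time_scales_def)

lemma Ts_dvd: "i \<le> j \<Longrightarrow> j \<le> k \<Longrightarrow> Ts i dvd Ts j"
proof (induction j rule: dec_induct)
  case (step j)
  then show ?case using Ts_dvd_Suc[of j] dvd_trans by auto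
qed auto

lemma Ts_pos: "i \<le> k \<Longrightarrow> 0 < Ts i"
proof (induction i)
  case 0
  then show ?case using time_scales by (auto simp: time_scales_def)
next
  case (Suc i)
  then show ?case using Ts_less_Suc[of i] by auto
qed

lemma Ts_dvd_T: "i \<le> k \<Longrightarrow> Ts i dvd T"
  by (simp add: T_eq Ts_dvd)

lemma interval_within_T:
  assumes "i \<le> k" "Ts i dvd u" "u < T"
  shows "u + Ts i \<le> T"
proof -
  obtain a b where ab: "u = Ts i * a" "T = Ts i * b"
    using assms(2) Ts_dvd_T[OF assms(1)] by (auto elim!: dvdE)
  have "a < b" using assms(3) ab by auto
  then have "Ts i * Suc a \<le> Ts i * b" by (intro mult_left_mono) auto
  then show ?thesis using ab by simp
qed

text \<open>By the divisibility chain the levels updated at \<open>t\<close> form an initial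
  segment. Hence the rest of the proof can describe an update level by level through
  \<open>Ts i dvd t\<close>.\<close>

lemma le_update_level_iff:
  assumes "Ts 0 dvd t" "i < k"
  shows "i \<le> update_level k Ts t \<longleftrightarrow> Ts i dvd t"
proof
  have "Max {i. i < k \<and> Ts i dvd t} \<in> {i. i < k \<and> Ts i dvd t}"
    using assms by (intro Max_in) (auto intro: exI[of _ i] exI[of _ 0])
  then have *: "update_level k Ts t < k" "Ts (update_level k Ts t) dvd t"
    by (auto simp: update_level_def)
  show "Ts i dvd t" if "i \<le> update_level k Ts t"
    using Ts_dvd[OF that] * dvd_trans by auto
  show "i \<le> update_level k Ts t" if "Ts i dvd t"
    unfolding update_level_def using that assms by (intro Max_ge) auto
qed

definition \<epsilon> :: real where "\<epsilon> = ln (real (Ts k)) / real m"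

abbreviation \<tau> :: "nat \<Rightarrow> nat" where "\<tau> \<equiv> epoch_start k Ts"

definition sample_pmf :: "nat \<Rightarrow> (nat \<Rightarrow> nat list) pmf" where
  "sample_pmf t =
     (if Ts 0 dvd t
      then Pi_pmf {..update_level k Ts t} [] (\<lambda>_. replicate_pmf m (pmf_of_set {..<n}))
      else return_pmf (\<lambda>_. []))"

definition after_update :: "nat \<Rightarrow> (nat \<Rightarrow> nat list) \<Rightarrow> hstate \<Rightarrow> hstate" where
  "after_update t X s =
     (if Ts 0 dvd t
      then let k' = update_level k Ts t in
        s\<lparr>bucket := sample_step smp k' t X
                      (forward_step fwd k' t (evict_step \<epsilon> k' (\<tau> t) (bucket s))),
          own_wt := (\<lambda>i. if i \<le> k' then 1 else own_wt s i),
          below_wt := (\<lambda>i. if i \<le> k' then 1 else below_wt s i)\<rparr>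
      else s)"

text \<open>
  The whole run is a deterministic function of the randomness \<open>w t = (X, e, c)\<close> of the days: the
  samples of the bucket update, the draws and the coins. \<open>mid w t\<close> is the state after the bucket
  update of day \<open>t\<close> and before its prediction.
\<close>

primrec st :: "(nat \<Rightarrow> day_randomness) \<Rightarrow> nat \<Rightarrow> hstate" where
  "st w 0 = init_state"
| "st w (Suc t) =
     observe k Ts (l t) (fst (snd (w t))) (snd (snd (w t))) (after_update t (fst (w t)) (st w t))"

definition mid :: "(nat \<Rightarrow> day_randomness) \<Rightarrow> nat \<Rightarrow> hstate" where
  "mid w t = after_update t (fst (w t)) (st w t)"

definition day_pmf :: "nat \<Rightarrow> (nat \<Rightarrow> day_randomness) \<Rightarrow> day_randomness pmf" where
  "day_pmf t w =
     bind_pmf (sample_pmf t) (\<lambda>X.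
     bind_pmf (draws k (after_update t X (st w t))) (\<lambda>e.
     map_pmf (\<lambda>c. (X, e, c)) (coins k (after_update t X (st w t)))))"

abbreviation run_pmf :: "nat \<Rightarrow> (nat \<Rightarrow> day_randomness) pmf" where
  "run_pmf \<equiv> path_pmf day_pmf"

lemma st_Suc: "st w (Suc t) = observe k Ts (l t) (fst (snd (w t))) (snd (snd (w t))) (mid w t)"
  by (simp add: mid_def)

lemma st_cong: "(\<And>r. r < t \<Longrightarrow> w r = w' r) \<Longrightarrow> st w t = st w' t"
  by (induction t) auto

lemma mid_cong: "(\<And>r. r \<le> t \<Longrightarrow> w r = w' r) \<Longrightarrow> mid w t = mid w' t"
  unfolding mid_def using st_cong[of t w w'] by auto

lemma st_upd [simp]: "t \<le> r \<Longrightarrow> st (w(r := x)) t = st w t"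
  by (rule st_cong) auto

lemma mid_upd [simp]: "t < r \<Longrightarrow> mid (w(r := x)) t = mid w t"
  by (rule mid_cong) auto

lemma mid_upd_same [simp]: "mid (w(t := x)) t = after_update t (fst x) (st w t)"
  by (simp add: mid_def)

text \<open>The randomness of a day is drawn in the same order as by the algorithm, so the laws of
  the state agree day by day, and events about the algorithm can be stated on paths.\<close>

lemma hier_run_conv_run_pmf:
  "hier_run k Ts n m fwd smp l d = map_pmf (\<lambda>w. st w d) (run_pmf d)"
proof (induction d)
  case (Suc t)
  have step: "bind_pmf (if Ts 0 dvd t then update_buckets k Ts n m fwd smp t s else return_pmf s)
                (predict_day k Ts (l t))
      = bind_pmf (sample_pmf t) (\<lambda>X. predict_day k Ts (l t) (after_update t X s))" for s
    by (auto simp: sample_pmf_def after_update_def update_buckets_def Let_def \<epsilon>_def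
        bind_map_pmf bind_return_pmf)
  show ?case
    by (simp add: Suc step day_pmf_def predict_day_def map_pmf_def bind_assoc_pmf bind_return_pmf)
qed simp

definition kept :: "(nat \<Rightarrow> day_randomness) \<Rightarrow> nat \<Rightarrow> nat \<Rightarrow> entry list" where
  "kept w t i = map (\<lambda>e. e\<lparr>weight := 1\<rparr>) (evict \<epsilon> (\<tau> t) (bucket (st w t) i))"

definition forwarded :: "(nat \<Rightarrow> day_randomness) \<Rightarrow> nat \<Rightarrow> nat \<Rightarrow> nat list" where
  "forwarded w t i = map expert (concat (map (kept w t) [0..<i]))"

lemma Ts0_dvd: "i < k \<Longrightarrow> Ts i dvd t \<Longrightarrow> Ts 0 dvd t"
  using Ts_dvd[of 0 i] dvd_trans by auto

lemma bucket_mid: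
  assumes "i < k"
  shows "bucket (mid w t) i =
    (if Ts i dvd t
     then kept w t i @ new_entries (fwd t i (length (forwarded w t i))) (forwarded w t i)
            @ new_entries (smp t i) (fst (w t) i)
     else bucket (st w t) i)"
proof (cases "Ts i dvd t")
  case True
  then have t0: "Ts 0 dvd t" using assms Ts0_dvd by blast
  have le: "i \<le> update_level k Ts t" using le_update_level_iff[OF t0 assms] True by simp
  have "concat (map (evict_step \<epsilon> (update_level k Ts t) (\<tau> t) (bucket (st w t))) [0..<i])
      = concat (map (kept w t) [0..<i])"
    using le by (intro arg_cong[where f = concat] map_cong) (auto simp: evict_step_def kept_def)
  then show ?thesis using True le t0
    by (simp add: mid_def after_update_def Let_def sample_step_def forward_step_def forwarded_def)
       (simp add: evict_step_def kept_def)
next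
  case False
  show ?thesis
  proof (cases "Ts 0 dvd t")
    case True
    then have "\<not> i \<le> update_level k Ts t" using le_update_level_iff[OF True assms] False by simp
    then show ?thesis using False True
      by (simp add: mid_def after_update_def Let_def sample_step_def forward_step_def evict_step_def)
  qed (use False in \<open>simp add: mid_def after_update_def\<close>)
qed

lemma wt_mid:
  assumes "i < k"
  shows "own_wt (mid w t) i = (if Ts i dvd t then 1 else own_wt (st w t) i)"
    and "below_wt (mid w t) i = (if Ts i dvd t then 1 else below_wt (st w t) i)"
  using le_update_level_iff[of t i] Ts0_dvd[of i t] assms
  by (auto simp: mid_def after_update_def Let_def)

abbreviation drawn :: "(nat \<Rightarrow> day_randomness) \<Rightarrow> nat \<Rightarrow> nat \<Rightarrow> nat" where
  "drawn w t i \<equiv> fst (snd (w t)) i"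

abbreviation chosen :: "(nat \<Rightarrow> day_randomness) \<Rightarrow> nat \<Rightarrow> nat \<Rightarrow> nat" where
  "chosen w t i \<equiv> choice (fst (snd (w t))) (snd (snd (w t))) i"

lemma played_st: "played (st w t) = map (\<lambda>t. chosen w t (k - 1)) [0..<t]"
proof (induction t)
  case (Suc t)
  have "played (mid w t) = played (st w t)" by (simp add: mid_def after_update_def Let_def)
  then show ?case by (simp add: st_Suc observe_def Suc del: st.simps)
qed (simp add: init_state_def)

section \<open>Invariants of the entries\<close>

text \<open>The facts on buckets hold for every path with well-formed samples; probability enters
  only to see that reachable paths are of this kind.\<close>

definition samples_ok :: "(nat \<Rightarrow> day_randomness) \<Rightarrow> nat \<Rightarrow> bool" where
  "samples_ok w d \<longleftrightarrow> (\<forall>t<d. \<forall>i<k. Ts i dvd t \<longrightarrow>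
     length (fst (w t) i) = m \<and> set (fst (w t) i) \<subseteq> {..<n})"

text \<open>Arrival times given on day \<open>t\<close> lie between \<open>t\<close> and
  \<open>t + 1\<close>, so the floor recovers the day, and the accumulated loss is a function of
  expert and arrival time. The bound \<open>b\<close> is \<open>t\<close> before the update of day
  \<open>t\<close> and \<open>t + 1\<close> after it.\<close>

definition entry_ok :: "real \<Rightarrow> nat \<Rightarrow> entry \<Rightarrow> bool" where
  "entry_ok b t E \<longleftrightarrow> expert E < n \<and> 0 < weight E \<and> 0 \<le> arrival E \<and> arrival E < b \<and>
     loss E = (\<Sum>d\<in>{nat \<lfloor>arrival E\<rfloor>..<t}. l d (expert E))"

lemma new_entries_ok:
  assumes "\<And>j. j < length xs \<Longrightarrow> real t \<le> a j \<and> a j < real t + 1" "set xs \<subseteq> {..<n}"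
    and "E \<in> set (new_entries a xs)"
  shows "entry_ok (real t + 1) t E \<and> real t \<le> arrival E"
proof -
  obtain j where j: "j < length xs" "E = \<lparr>expert = xs ! j, arrival = a j, loss = 0, weight = 1\<rparr>"
    using assms(3) by (auto simp: new_entries_def)
  have "nat \<lfloor>a j\<rfloor> = t" using assms(1)[OF j(1)] by linarith
  moreover have "xs ! j < n" using assms(2) j(1) nth_mem by blast
  moreover have "0 \<le> a j" using assms(1)[OF j(1)] of_nat_0_le_iff[of t, where 'a = real] by linarith
  ultimately show ?thesis using assms(1)[OF j(1)] by (auto simp: j(2) entry_ok_def)
qed

lemma fwd_bounds: "j < N \<Longrightarrow> real t \<le> fwd t i N j \<and> fwd t i N j < real t + 1/2"
  using arrival_scheme unfolding arrival_scheme_def by fastforce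

lemma smp_bounds: "j < m \<Longrightarrow> real t + 1/2 \<le> smp t i j \<and> smp t i j < real t + 1"
  using arrival_scheme unfolding arrival_scheme_def by fastforce

lemma smp_inj: "inj_on (smp t i) {..<m}"
  using arrival_scheme unfolding arrival_scheme_def by blast

lemma entries_ok_update:
  assumes st: "\<And>j E. j < k \<Longrightarrow> E \<in> set (bucket (st w t) j) \<Longrightarrow> entry_ok (real t) t E"
    and X: "Ts i dvd t \<Longrightarrow> length (fst (w t) i) = m \<and> set (fst (w t) i) \<subseteq> {..<n}"
    and i: "i < k" and E: "E \<in> set (bucket (mid w t) i)"
  shows "entry_ok (real t + 1) t E"
proof (cases "Ts i dvd t")
  case True
  have kept: "entry_ok (real t + 1) t E" if "E \<in> set (kept w t j)" "j < k" for E j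
    using st that by (fastforce simp: kept_def evict_def entry_ok_def)
  have fw: "set (forwarded w t i) \<subseteq> {..<n}"
    using kept i by (fastforce simp: forwarded_def entry_ok_def)
  have b1: "real t \<le> fwd t i (length (forwarded w t i)) j
      \<and> fwd t i (length (forwarded w t i)) j < real t + 1"
    if "j < length (forwarded w t i)" for j
    using fwd_bounds[OF that, of t i] by linarith
  have b2: "real t \<le> smp t i j \<and> smp t i j < real t + 1" if "j < length (fst (w t) i)" for j
    using smp_bounds[of j t i] that X[OF True] by linarith
  show ?thesis
    using E True i kept[of E i] new_entries_ok[OF b1 fw] new_entries_ok[OF b2] X[OF True]
    by (auto simp: bucket_mid)
next
  case False
  then show ?thesis using st[OF i] E i by (fastforce simp: bucket_mid entry_ok_def)
qed

lemma entry_ok_observe: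
  assumes "entry_ok (real t + 1) t E"
  shows "entry_ok (real (Suc t)) (Suc t)
     (E\<lparr>loss := loss E + l t (expert E), weight := weight E * exp z\<rparr>)"
proof -
  have "nat \<lfloor>arrival E\<rfloor> \<le> t" using assms unfolding entry_ok_def by linarith
  then show ?thesis using assms by (auto simp: entry_ok_def)
qed

lemma bucket_st_Suc:
  "bucket (st w (Suc t)) i =
     map (\<lambda>E. E\<lparr>loss := loss E + l t (expert E),
              weight := weight E * exp (- sqrt (ln (real (length (bucket (mid w t) i))) / real (Ts i))
                                          * l t (expert E))\<rparr>) (bucket (mid w t) i)"
  by (simp add: st_Suc observe_def Let_def del: st.simps)

lemma entries_ok:
  assumes "samples_ok w d"
  shows st_entries_ok: "t \<le> d \<Longrightarrow> i < k \<Longrightarrow> E \<in> set (bucket (st w t) i) \<Longrightarrow> entry_ok (real t) t E"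
    and mid_entries_ok: "t < d \<Longrightarrow> i < k \<Longrightarrow> E \<in> set (bucket (mid w t) i) \<Longrightarrow> entry_ok (real t + 1) t E"
proof -
  show *: "entry_ok (real t) t E"
    if "t \<le> d" "i < k" "E \<in> set (bucket (st w t) i)" for t i E
    using that
  proof (induction t arbitrary: i E)
    case 0
    then show ?case by (simp add: init_state_def)
  next
    case (Suc t)
    then obtain E' z where E': "E' \<in> set (bucket (mid w t) i)"
        "E = E'\<lparr>loss := loss E' + l t (expert E'), weight := weight E' * exp z\<rparr>"
      by (auto simp: bucket_st_Suc simp del: st.simps)
    have "entry_ok (real t + 1) t E'"
      using Suc assms E'(1) by (intro entries_ok_update[of w t i]) (auto simp: samples_ok_def)
    then show ?case unfolding E'(2) by (rule entry_ok_observe)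
  qed
  show "entry_ok (real t + 1) t E" if "t < d" "i < k" "E \<in> set (bucket (mid w t) i)"
    using that assms * by (intro entries_ok_update[of w t i]) (auto simp: samples_ok_def)
qed

lemma bucket_mid_nonempty:
  assumes "samples_ok w d" "t < d" "i < k"
  shows "bucket (mid w t) i \<noteq> []"
  using assms(2)
proof (induction t)
  case 0
  then show ?case using assms m_pos by (auto simp: bucket_mid samples_ok_def new_entries_def)
next
  case (Suc t)
  then have "bucket (st w (Suc t)) i \<noteq> []" by (simp add: bucket_st_Suc del: st.simps)
  then show ?case
    using Suc.prems assms m_pos
    by (auto simp: bucket_mid samples_ok_def new_entries_def simp del: st.simps)
qed

lemma set_pmf_sample_pmf:
  assumes "X \<in> set_pmf (sample_pmf t)" "i < k" "Ts i dvd t"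
  shows "length (X i) = m \<and> set (X i) \<subseteq> {..<n}"
proof -
  have t0: "Ts 0 dvd t" using assms Ts0_dvd by blast
  then have "i \<le> update_level k Ts t" using le_update_level_iff assms by blast
  moreover have "{..<n} \<noteq> {}" using n_pos by auto
  ultimately show ?thesis
    using assms(1) t0 by (auto simp: sample_pmf_def set_Pi_pmf PiE_dflt_def set_replicate_pmf)
qed

lemma samples_ok_run_pmf: "w \<in> set_pmf (run_pmf d) \<Longrightarrow> samples_ok w d"
proof (induction d arbitrary: w)
  case 0
  then show ?case by (simp add: samples_ok_def)
next
  case (Suc d)
  then obtain v x where v: "v \<in> set_pmf (run_pmf d)" "x \<in> set_pmf (day_pmf d v)" "w = v(d := x)"
    by auto
  then have "fst x \<in> set_pmf (sample_pmf d)" by (auto simp: day_pmf_def)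
  with Suc.IH[OF v(1)] set_pmf_sample_pmf show ?case
    unfolding samples_ok_def v(3) by (auto simp: less_Suc_eq)
qed

lemma samples_ok_upd:
  assumes "w \<in> set_pmf (run_pmf t)" "X \<in> set_pmf (sample_pmf t)"
  shows "samples_ok (w(t := (X, e, c))) (Suc t)"
  using samples_ok_run_pmf[OF assms(1)] set_pmf_sample_pmf[OF assms(2)]
  by (auto simp: samples_ok_def less_Suc_eq)

definition draw_ok :: "entry list \<Rightarrow> bool" where
  "draw_ok B \<longleftrightarrow> B \<noteq> [] \<and> (\<forall>E\<in>set B. 0 < weight E \<and> expert E < n)"

lemma draw_ok_after_update:
  assumes "w \<in> set_pmf (run_pmf t)" "X \<in> set_pmf (sample_pmf t)" "i < k"
  shows "draw_ok (bucket (after_update t X (st w t)) i)"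
proof -
  define w' where "w' = w(t := (X, undefined, undefined))"
  have ok: "samples_ok w' (Suc t)" using samples_ok_upd assms by (simp add: w'_def)
  have "after_update t X (st w t) = mid w' t" by (simp add: w'_def)
  then show ?thesis
    using bucket_mid_nonempty[OF ok _ assms(3)] mid_entries_ok[OF ok _ assms(3)]
    by (auto simp: draw_ok_def entry_ok_def)
qed

lemma draw_ok_wf:
  assumes "draw_ok B"
  shows "0 < (\<Sum>E\<leftarrow>B. weight E)"
    and "pmf_of_list_wf (map (\<lambda>E. (E, weight E / (\<Sum>E'\<leftarrow>B. weight E'))) B)"
proof -
  show pos: "0 < (\<Sum>E\<leftarrow>B. weight E)"
    using assms unfolding draw_ok_def
  proof (induction B)
    case (Cons E B)
    then show ?case by (cases "B = []") (auto intro: add_pos_pos)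
  qed simp
  show "pmf_of_list_wf (map (\<lambda>E. (E, weight E / (\<Sum>E'\<leftarrow>B. weight E'))) B)"
  proof (rule pmf_of_list_wfI)
    show "x \<ge> 0" if "x \<in> set (map snd (map (\<lambda>E. (E, weight E / (\<Sum>E'\<leftarrow>B. weight E'))) B))" for x
      using that pos assms unfolding draw_ok_def by (auto intro!: divide_nonneg_nonneg less_imp_le)
    have "sum_list (map snd (map (\<lambda>E. (E, weight E / (\<Sum>E'\<leftarrow>B. weight E'))) B))
        = (\<Sum>E\<leftarrow>B. weight E * inverse (\<Sum>E'\<leftarrow>B. weight E'))"
      by (simp add: o_def divide_inverse)
    also have "\<dots> = 1" using pos by (subst sum_list_mult_const) simp
    finally show "sum_list (map snd (map (\<lambda>E. (E, weight E / (\<Sum>E'\<leftarrow>B. weight E'))) B)) = 1" .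
  qed
qed

lemma set_pmf_draw_expert:
  assumes "draw_ok B"
  shows "set_pmf (draw_expert B) \<subseteq> {..<n}"
  using set_pmf_of_list[OF draw_ok_wf(2)[OF assms]] assms
  by (fastforce simp: draw_expert_def draw_ok_def)

lemma choice_less:
  assumes "\<And>i. i < k \<Longrightarrow> e i < n" "i < k"
  shows "choice e c i < n"
  using assms(2) by (induction i) (use assms(1) in auto)

lemma draws_less:
  assumes "\<And>i. i < k \<Longrightarrow> draw_ok (bucket s i)" "e \<in> set_pmf (draws k s)" "i < k"
  shows "e i < n"
  using assms set_pmf_draw_expert by (fastforce simp: draws_def set_Pi_pmf PiE_dflt_def)

lemma drawn_less:
  assumes "w \<in> set_pmf (run_pmf d)" "t < d" "i < k"
  shows "drawn w t i < n"
  using assms(1,2)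
proof (induction d arbitrary: w)
  case (Suc d)
  then obtain v x where v: "v \<in> set_pmf (run_pmf d)" "x \<in> set_pmf (day_pmf d v)" "w = v(d := x)"
    by auto
  show ?case
  proof (cases "t = d")
    case True
    have "fst (snd x) i < n"
      using v(2) draws_less[OF draw_ok_after_update[OF v(1)] _ assms(3)] by (auto simp: day_pmf_def)
    then show ?thesis using v(3) True by simp
  next
    case False
    then show ?thesis using Suc v by auto
  qed
qed simp

lemma chosen_less:
  assumes "w \<in> set_pmf (run_pmf d)" "t < d" "i < k"
  shows "chosen w t i < n"
  using drawn_less[OF assms(1,2)] assms(3) by (intro choice_less) auto

section \<open>Weights between two updates of a level\<close>

text \<open>The length of a bucket changes at updates of its level only, so the learning rate is
  constant in between and the weights are those of exponential weights started at
  \<open>u\<close>.\<close>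

lemma bucket_within_interval:
  fixes w :: "nat \<Rightarrow> day_randomness"
  assumes i: "i < k" and u: "Ts i dvd u" and j: "j < Ts i"
  defines "B \<equiv> bucket (mid w u) i"
  defines "\<eta> \<equiv> sqrt (ln (real (length B)) / real (Ts i))"
  shows "bucket (mid w (u + j)) i =
     map (\<lambda>E. E\<lparr>loss := loss E + (\<Sum>r<j. l (u + r) (expert E)),
              weight := exp (- \<eta> * (\<Sum>r<j. l (u + r) (expert E)))\<rparr>) B"
  using j
proof (induction j)
  case 0
  \<comment> \<open>Right after the update all weights are 1: kept entries are reset, and added ones
    start there.\<close>
  have "E\<lparr>weight := 1\<rparr> = E" if "E \<in> set B" for E
    using that u i by (auto simp: B_def bucket_mid kept_def new_entries_def)
  then show ?case by (simp add: map_idI flip: B_def)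
next
  case (Suc j)
  have "\<not> Ts i dvd u + Suc j" using u Suc.prems by (meson dvd_add_right_iff nat_dvd_not_less zero_less_Suc)
  then have "bucket (mid w (u + Suc j)) i = bucket (st w (Suc (u + j))) i"
    using i by (simp add: bucket_mid del: st.simps)
  also have "\<dots> = map (\<lambda>E. E\<lparr>loss := loss E + (\<Sum>r<Suc j. l (u + r) (expert E)),
              weight := exp (- \<eta> * (\<Sum>r<Suc j. l (u + r) (expert E)))\<rparr>) B"
    using Suc
    by (simp add: bucket_st_Suc \<eta>_def algebra_simps exp_diff exp_minus divide_simps flip: exp_add
          del: st.simps)
  finally show ?case .
qed

lemma wt_within_interval:
  assumes i: "i < k" and u: "Ts i dvd u" and j: "j < Ts i"
  shows "own_wt (mid w (u + j)) i
           = exp (- sqrt (2 / real (Ts i)) * (\<Sum>r<j. l (u + r) (drawn w (u + r) i)))"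
    and "below_wt (mid w (u + j)) i
           = exp (- sqrt (2 / real (Ts i)) * (\<Sum>r<j. l (u + r) (chosen w (u + r) (i - 1))))"
proof -
  have "own_wt (mid w (u + j)) i
           = exp (- sqrt (2 / real (Ts i)) * (\<Sum>r<j. l (u + r) (drawn w (u + r) i))) \<and>
        below_wt (mid w (u + j)) i
           = exp (- sqrt (2 / real (Ts i)) * (\<Sum>r<j. l (u + r) (chosen w (u + r) (i - 1))))"
    using j
  proof (induction j)
    case 0
    then show ?case using u i by (simp add: wt_mid)
  next
    case (Suc j)
    have "\<not> Ts i dvd u + Suc j"
      using u Suc.prems by (meson dvd_add_right_iff nat_dvd_not_less zero_less_Suc)
    with Suc show ?case
      using i by (simp add: wt_mid st_Suc observe_def distrib_left exp_add exp_diff divide_simps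
          exp_minus del: st.simps)
  qed
  then show "own_wt (mid w (u + j)) i
           = exp (- sqrt (2 / real (Ts i)) * (\<Sum>r<j. l (u + r) (drawn w (u + r) i)))"
    "below_wt (mid w (u + j)) i
           = exp (- sqrt (2 / real (Ts i)) * (\<Sum>r<j. l (u + r) (chosen w (u + r) (i - 1))))"
    by auto
qed

end

context hierarchy
begin

subsection \<open>Regret within the intervals of one level\<close>

text \<open>For \<open>f = l t\<close> and the bucket after the update of day \<open>t\<close>, the
  conditional mean of the loss of the drawn expert, given the past and the samples of the
  day.\<close>

definition mean_loss :: "(nat \<Rightarrow> real) \<Rightarrow> entry list \<Rightarrow> real" where
  "mean_loss f B = (\<Sum>E\<leftarrow>B. weight E * f (expert E)) / (\<Sum>E\<leftarrow>B. weight E)"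

text \<open>The conditional mean of the loss of level \<open>i\<close> once the draws and the lower
  coins of the same day are known; only then do the two options have definite losses.\<close>

definition mean_choice_loss :: "(nat \<Rightarrow> day_randomness) \<Rightarrow> nat \<Rightarrow> nat \<Rightarrow> real" where
  "mean_choice_loss w t i =
     (own_wt (mid w t) i * l t (drawn w t i) + below_wt (mid w t) i * l t (chosen w t (i - 1)))
       / (own_wt (mid w t) i + below_wt (mid w t) i)"

lemma mean_loss_regret:
  assumes w: "samples_ok w T" and i: "i < k" and u: "Ts i dvd u" "u < T"
    and x: "x \<in> expert ` set (bucket (mid w u) i)"
  shows "(\<Sum>j<Ts i. mean_loss (l (u + j)) (bucket (mid w (u + j)) i))
           \<le> (\<Sum>j<Ts i. l (u + j) x)
             + 2 * sqrt (real (Ts i) * ln (real (length (bucket (mid w u) i))))"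
proof -
  define B where "B = bucket (mid w u) i"
  \<comment> \<open>The options are list positions, so that a repeated expert counts with its
    multiplicity.\<close>
  define I where "I = {..<length B}"
  define v where "v = (\<lambda>b j. l (u + j) (expert (B ! b)))"
  define \<eta> where "\<eta> = sqrt (ln (real (card I)) / real (Ts i))"
  have le: "u + Ts i \<le> T" using interval_within_T i u by simp
  obtain a where a: "a \<in> I" "x = expert (B ! a)"
    using x by (auto simp: B_def I_def in_set_conv_nth)
  have n: "expert (B ! b) < n" if "b \<in> I" for b
    using mid_entries_ok[OF w u(2) i, of "B ! b"] that by (simp add: B_def I_def entry_ok_def)
  have "mean_loss (l (u + j)) (bucket (mid w (u + j)) i)
      = (\<Sum>b\<in>I. exp (- \<eta> * (\<Sum>r<j. v b r)) * v b j) / (\<Sum>b\<in>I. exp (- \<eta> * (\<Sum>r<j. v b r)))"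
    if "j < Ts i" for j
    unfolding mean_loss_def bucket_within_interval[OF i u(1) that] \<eta>_def v_def I_def B_def
    by (simp add: sum_list_sum_nth atLeast0LessThan)
  then have "(\<Sum>j<Ts i. mean_loss (l (u + j)) (bucket (mid w (u + j)) i))
      = (\<Sum>j<Ts i. (\<Sum>b\<in>I. exp (- \<eta> * (\<Sum>r<j. v b r)) * v b j)
                    / (\<Sum>b\<in>I. exp (- \<eta> * (\<Sum>r<j. v b r))))"
    by (intro sum.cong) auto
  also have "\<dots> \<le> (\<Sum>j<Ts i. v a j) + 2 * sqrt (real (Ts i) * ln (real (card I)))"
    unfolding \<eta>_def
  proof (rule tuned_exponential_weights_regret)
    show "0 \<le> v b s \<and> v b s \<le> 1" if "b \<in> I" "s < Ts i" for b s
      using loss_bounds[of "u + s"] n[OF that(1)] le that(2) by (simp add: v_def)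
  qed (use a in \<open>auto simp: I_def\<close>)
  finally show ?thesis by (simp add: v_def a(2) I_def B_def)
qed

lemma mean_choice_loss_regret:
  assumes w: "w \<in> set_pmf (run_pmf T)" and i: "i < k" "0 < i" and u: "Ts i dvd u" "u < T"
  shows "(\<Sum>j<Ts i. mean_choice_loss w (u + j) i)
           \<le> (\<Sum>j<Ts i. l (u + j) (drawn w (u + j) i)) + 3 * sqrt (real (Ts i))"
    and "(\<Sum>j<Ts i. mean_choice_loss w (u + j) i)
           \<le> (\<Sum>j<Ts i. l (u + j) (chosen w (u + j) (i - 1))) + 3 * sqrt (real (Ts i))"
proof -
  define \<eta> where "\<eta> = sqrt (2 / real (Ts i))"
  define v where "v = (\<lambda>b j. if b then l (u + j) (drawn w (u + j) i)
                             else l (u + j) (chosen w (u + j) (i - 1)))"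
  have le: "u + Ts i \<le> T" using interval_within_T i u by simp
  have pos: "0 < real (Ts i)" using Ts_pos[of i] i by simp
  have \<eta>: "0 < \<eta>" using pos by (simp add: \<eta>_def)
  have sq: "\<eta>\<^sup>2 * real (Ts i) = 2" using pos by (simp add: \<eta>_def)
  have prod: "\<eta> * sqrt (real (Ts i)) = sqrt 2" using pos by (simp add: \<eta>_def flip: real_sqrt_mult)
  have v: "0 \<le> v b j \<and> v b j \<le> 1" if "j < Ts i" for b j
    using that le loss_bounds drawn_less[OF w, of "u + j" i] chosen_less[OF w, of "u + j" "i - 1"] i
    by (auto simp: v_def)
  have ln2: "ln (2::real) \<le> 1" using ln_le_minus_one[of 2] by simp
  have "1 \<le> sqrt (2::real)" by simp
  have main: "(\<Sum>j<Ts i. mean_choice_loss w (u + j) i) \<le> (\<Sum>j<Ts i. v a j) + 3 * sqrt (real (Ts i))" for a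
  proof -
    have "\<eta> * (\<Sum>j<Ts i. mean_choice_loss w (u + j) i)
        = \<eta> * (\<Sum>j<Ts i. (\<Sum>b\<in>UNIV. exp (- \<eta> * (\<Sum>r<j. v b r)) * v b j)
                        / (\<Sum>b\<in>UNIV. exp (- \<eta> * (\<Sum>r<j. v b r))))"
      using wt_within_interval[OF i(1) u(1)]
      by (intro arg_cong[where f = "\<lambda>x. \<eta> * x"] sum.cong)
         (auto simp: mean_choice_loss_def UNIV_bool v_def \<eta>_def algebra_simps)
    also have "\<dots> \<le> \<eta> * (\<Sum>j<Ts i. v a j) + ln (real (card (UNIV :: bool set)))
                     + \<eta>\<^sup>2 * real (Ts i)"
      by (rule exponential_weights_regret) (use v \<eta> in auto)
    \<comment> \<open>The additive terms are \<open>ln 2 + 2 \<le> 3\<close>, and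
      \<open>3 \<le> 3 * sqrt 2\<close>, where \<open>sqrt 2 = \<eta> * sqrt (Ts i)\<close>.\<close>
    also have "\<dots> \<le> \<eta> * (\<Sum>j<Ts i. v a j) + 3 * (\<eta> * sqrt (real (Ts i)))"
      unfolding sq prod card_UNIV_bool using ln2 \<open>1 \<le> sqrt 2\<close>
      by (simp only: of_nat_numeral)
    also have "\<dots> = \<eta> * ((\<Sum>j<Ts i. v a j) + 3 * sqrt (real (Ts i)))" by (simp add: algebra_simps)
    finally show ?thesis using \<eta> by simp
  qed
  from main[of True] show "(\<Sum>j<Ts i. mean_choice_loss w (u + j) i)
           \<le> (\<Sum>j<Ts i. l (u + j) (drawn w (u + j) i)) + 3 * sqrt (real (Ts i))"
    by (simp add: v_def)
  from main[of False] show "(\<Sum>j<Ts i. mean_choice_loss w (u + j) i)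
           \<le> (\<Sum>j<Ts i. l (u + j) (chosen w (u + j) (i - 1))) + 3 * sqrt (real (Ts i))"
    by (simp add: v_def)
qed

section \<open>Deviation of draws and coins from their conditional means\<close>

lemma nn_integral_draw_expert_le_1:
  assumes B: "draw_ok B" and f: "\<And>x. x < n \<Longrightarrow> 0 \<le> f x \<and> f x \<le> 1" and r: "r \<le> 1"
  shows "(\<integral>\<^sup>+x. ennreal (exp (r * (f x - mean_loss f B) - r\<^sup>2)) \<partial>draw_expert B) \<le> 1"
proof -
  define W where "W = (\<Sum>E\<leftarrow>B. weight E)"
  define c where "c = r * mean_loss f B + r\<^sup>2"
  note pos = draw_ok_wf(1)[OF B, folded W_def] and wf = draw_ok_wf(2)[OF B, folded W_def]
  have idx: "expert (B ! b) < n" "0 < weight (B ! b)" if "b < length B" for b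
    using B that nth_mem by (auto simp: draw_ok_def)
  have W: "W = (\<Sum>b<length B. weight (B ! b))"
    by (simp add: W_def sum_list_sum_nth atLeast0LessThan)
  have mean: "mean_loss f B = (\<Sum>b<length B. weight (B ! b) * f (expert (B ! b))) / W"
    by (simp add: mean_loss_def W_def sum_list_sum_nth atLeast0LessThan)
  have "(\<integral>\<^sup>+x. ennreal (exp (r * (f x - mean_loss f B) - r\<^sup>2)) \<partial>draw_expert B)
      = ennreal (\<Sum>E\<leftarrow>B. exp (r * (f (expert E) - mean_loss f B) - r\<^sup>2) * (weight E / W))"
    unfolding draw_expert_def nn_integral_map_pmf W_def[symmetric]
    by (subst nn_integral_pmf_of_list[OF wf]) (auto simp: o_def)
  also have "(\<Sum>E\<leftarrow>B. exp (r * (f (expert E) - mean_loss f B) - r\<^sup>2) * (weight E / W))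
      = (\<Sum>b<length B. weight (B ! b) * exp (r * f (expert (B ! b)))) * (exp (- c) / W)"
  proof -
    have "exp (r * (v - mean_loss f B) - r\<^sup>2) = exp (r * v) * exp (- c)" for v
      by (simp add: c_def algebra_simps flip: exp_add)
    then show ?thesis
      by (simp add: sum_list_sum_nth atLeast0LessThan sum_distrib_left sum_divide_distrib mult_ac)
  qed
  also have "\<dots> \<le> (W * exp c) * (exp (- c) / W)"
    unfolding c_def mean using weighted_sum_exp_le[of "{..<length B}"
        "\<lambda>b. weight (B ! b)" "\<lambda>b. f (expert (B ! b))" r] idx f r pos W
    by (intro mult_right_mono) (auto intro: less_imp_le)
  also have "\<dots> = 1" using pos by (simp add: exp_minus)
  finally show ?thesis by (simp add: ennreal_leI flip: ennreal_1)
qed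

lemma nn_integral_day_pmf_le_1:
  assumes "\<And>X e. X \<in> set_pmf (sample_pmf t) \<Longrightarrow> e \<in> set_pmf (draws k (after_update t X (st w t))) \<Longrightarrow>
      (\<integral>\<^sup>+c. g (X, e, c) \<partial>coins k (after_update t X (st w t))) \<le> 1"
  shows "(\<integral>\<^sup>+x. g x \<partial>day_pmf t w) \<le> 1"
proof -
  have "(\<integral>\<^sup>+x. g x \<partial>day_pmf t w)
      = (\<integral>\<^sup>+X. (\<integral>\<^sup>+e. (\<integral>\<^sup>+c. g (X, e, c) \<partial>coins k (after_update t X (st w t)))
           \<partial>draws k (after_update t X (st w t))) \<partial>sample_pmf t)"
    by (simp add: day_pmf_def)
  also have "\<dots> \<le> (\<integral>\<^sup>+X. (\<integral>\<^sup>+e. 1 \<partial>draws k (after_update t X (st w t))) \<partial>sample_pmf t)"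
    by (intro nn_integral_mono_AE AE_pmfI assms)
  also have "\<dots> = 1" by simp
  finally show ?thesis .
qed

text \<open>Once the samples of the day are fixed, the factor sees only coordinate \<open>i\<close>
  of the draws, and the law of that coordinate is \<open>draw_expert\<close> of the updated
  bucket.\<close>

lemma draws_step:
  assumes w: "w \<in> set_pmf (run_pmf t)" and t: "t < T" and i: "i < k" and r: "r \<le> 1"
  defines "H \<equiv> (\<lambda>w. exp (r * (l t (drawn w t i) - mean_loss (l t) (bucket (mid w t) i)) - r\<^sup>2))"
  shows "(\<integral>\<^sup>+x. ennreal (H (w(t := x))) \<partial>day_pmf t w) \<le> 1"
proof -
  have "(\<integral>\<^sup>+e. ennreal (exp (r * (l t (e i)
            - mean_loss (l t) (bucket (after_update t X (st w t)) i)) - r\<^sup>2))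
          \<partial>draws k (after_update t X (st w t))) \<le> 1"
    if X: "X \<in> set_pmf (sample_pmf t)" for X
  proof -
    define B where "B = bucket (after_update t X (st w t)) i"
    have draw: "map_pmf (\<lambda>e. e i) (draws k (after_update t X (st w t))) = draw_expert B"
      using i by (simp add: draws_def Pi_pmf_component B_def)
    have "(\<integral>\<^sup>+e. ennreal (exp (r * (l t (e i) - mean_loss (l t) B) - r\<^sup>2))
          \<partial>draws k (after_update t X (st w t)))
        = (\<integral>\<^sup>+x. ennreal (exp (r * (l t x - mean_loss (l t) B) - r\<^sup>2)) \<partial>draw_expert B)"
      by (simp flip: draw)
    also have "\<dots> \<le> 1"
      using draw_ok_after_update[OF w X i] loss_bounds[OF t] r
      by (intro nn_integral_draw_expert_le_1) (auto simp: B_def)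
    finally show ?thesis by (simp add: B_def)
  qed
  then have "(\<integral>\<^sup>+x. ennreal (H (w(t := x))) \<partial>day_pmf t w) \<le> (\<integral>\<^sup>+X. 1 \<partial>sample_pmf t)"
    unfolding day_pmf_def nn_integral_bind_pmf nn_integral_map_pmf
    by (intro nn_integral_mono_AE AE_pmfI) (simp add: H_def)
  then show ?thesis by simp
qed

lemma wt_pos: "0 < own_wt (st w t) i \<and> 0 < below_wt (st w t) i"
proof (induction t)
  case 0
  then show ?case by (simp add: init_state_def)
next
  case (Suc t)
  then show ?case by (auto simp: observe_def after_update_def Let_def)
qed

lemma wt_after_update_pos:
  "0 < own_wt (after_update t X (st w t)) i" "0 < below_wt (after_update t X (st w t)) i"
  using wt_pos[of w t i] by (auto simp: after_update_def Let_def)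

lemma nn_integral_bernoulli_exp_le_1:
  fixes a b v1 v2 :: real
  assumes "0 < a" "0 < b" "0 \<le> v1" "v1 \<le> 1" "0 \<le> v2" "v2 \<le> 1" and r: "r \<le> 1"
  shows "(\<integral>\<^sup>+y. ennreal (exp (r * ((if y then v1 else v2) - (a * v1 + b * v2) / (a + b)) - r\<^sup>2))
           \<partial>bernoulli_pmf (a / (a + b))) \<le> 1"
proof -
  define c where "c = r * ((a * v1 + b * v2) / (a + b)) + r\<^sup>2"
  have p: "0 \<le> a / (a + b)" "a / (a + b) \<le> 1" and q: "1 - a / (a + b) = b / (a + b)"
    using assms by (auto simp: field_simps)
  have "(\<integral>\<^sup>+y. ennreal (exp (r * ((if y then v1 else v2) - (a * v1 + b * v2) / (a + b)) - r\<^sup>2))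
           \<partial>bernoulli_pmf (a / (a + b)))
      = ennreal (exp (r * v1 - c) * (a / (a + b)) + exp (r * v2 - c) * (b / (a + b)))"
  proof -
    have "(\<integral>\<^sup>+y. ennreal (F y) \<partial>bernoulli_pmf (a / (a + b)))
        = ennreal (F True * (a / (a + b)) + F False * (b / (a + b)))"
      if "\<And>y. 0 \<le> F y" for F :: "bool \<Rightarrow> real"
      using that p assms by (subst nn_integral_bernoulli_pmf) (auto simp: q ennreal_mult ennreal_plus
          simp del: times_divide_eq_right)
    from this[of "\<lambda>y. exp (r * ((if y then v1 else v2) - (a * v1 + b * v2) / (a + b)) - r\<^sup>2)"]
    show ?thesis by (simp add: c_def right_diff_distrib diff_diff_eq)
  qed
  also have "exp (r * v1 - c) * (a / (a + b)) + exp (r * v2 - c) * (b / (a + b))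
      = (a * exp (r * v1) + b * exp (r * v2)) * (exp (- c) / (a + b))"
    by (simp add: exp_diff exp_minus add_divide_distrib algebra_simps divide_simps)
  also have "\<dots> \<le> ((a + b) * exp c) * (exp (- c) / (a + b))"
    using weighted_sum_exp_le[of "UNIV :: bool set" "\<lambda>y. if y then a else b"
        "\<lambda>y. if y then v1 else v2" r] assms
    by (intro mult_right_mono) (auto simp: UNIV_bool c_def add.commute)
  also have "\<dots> = 1" using assms by (simp add: exp_minus)
  finally show ?thesis by (simp add: ennreal_leI flip: ennreal_1)
qed

lemma choice_upd: "j < i \<Longrightarrow> choice e (c(i := y)) j = choice e c j"
  by (induction j) auto

lemma coins_step:
  assumes w: "w \<in> set_pmf (run_pmf t)" and t: "t < T" and i: "i < k" "0 < i" and r: "r \<le> 1"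
  defines "H \<equiv> (\<lambda>w. exp (r * (l t (chosen w t i) - mean_choice_loss w t i) - r\<^sup>2))"
  shows "(\<integral>\<^sup>+x. ennreal (H (w(t := x))) \<partial>day_pmf t w) \<le> 1"
proof (rule nn_integral_day_pmf_le_1)
  fix X e assume X: "X \<in> set_pmf (sample_pmf t)"
    and e: "e \<in> set_pmf (draws k (after_update t X (st w t)))"
  define s where "s = after_update t X (st w t)"
  define p where "p = (\<lambda>i. bernoulli_pmf (own_wt s i / (own_wt s i + below_wt s i)))"
  define R where "R = Pi_pmf ({1..<k} - {i}) False p"
  define G where "G = (\<lambda>c. exp (r * (l t (choice e c i)
      - (own_wt s i * l t (e i) + below_wt s i * l t (choice e c (i - 1)))
          / (own_wt s i + below_wt s i)) - r\<^sup>2))"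
  obtain i' where i': "i = Suc i'" using i by (cases i) auto
  have less: "e j < n" if "j < k" for j
    using draws_less[OF draw_ok_after_update[OF w X] e that] by simp
  \<comment> \<open>The coin of level \<open>i\<close> is tossed last. The choice of level
    \<open>i - 1\<close> depends on lower coins only, so both options are fixed before the
    toss.\<close>
  have "coins k s = Pi_pmf (insert i ({1..<k} - {i})) False p"
    using i by (simp add: coins_def p_def insert_absorb)
  also have "\<dots> = bind_pmf (p i) (\<lambda>y. bind_pmf R (\<lambda>f. return_pmf (f(i := y))))"
    by (subst Pi_pmf_insert') (simp_all add: R_def)
  also have "\<dots> = bind_pmf R (\<lambda>f. map_pmf (\<lambda>y. f(i := y)) (p i))"
    by (subst bind_commute_pmf) (simp add: map_pmf_def)
  finally have coins: "coins k s = bind_pmf R (\<lambda>f. map_pmf (\<lambda>y. f(i := y)) (p i))" .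
  have "(\<integral>\<^sup>+y. ennreal (G (f(i := y))) \<partial>p i) \<le> 1" for f
  proof -
    have "G (f(i := y)) = exp (r * ((if y then l t (e i) else l t (choice e f i'))
        - (own_wt s i * l t (e i) + below_wt s i * l t (choice e f i'))
            / (own_wt s i + below_wt s i)) - r\<^sup>2)" for y
      by (simp add: G_def i' choice_upd)
    moreover have "choice e f i' < n" using less i' i by (intro choice_less) auto
    ultimately show ?thesis
      using loss_bounds[OF t less[OF i(1)]] loss_bounds[OF t, of "choice e f i'"] r
        wt_after_update_pos[of t X w i]
      unfolding p_def s_def by (simp only:) (rule nn_integral_bernoulli_exp_le_1; simp)
  qed
  then have "(\<integral>\<^sup>+f. (\<integral>\<^sup>+y. ennreal (G (f(i := y))) \<partial>p i) \<partial>R) \<le> (\<integral>\<^sup>+f. 1 \<partial>R)"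
    by (intro nn_integral_mono) auto
  then have "(\<integral>\<^sup>+c. ennreal (G c) \<partial>coins k s) \<le> 1" by (simp add: coins)
  moreover have "H (w(t := (X, e, c))) = G c" for c
    by (simp add: H_def G_def mean_choice_loss_def s_def)
  ultimately show "(\<integral>\<^sup>+c. ennreal (H (w(t := (X, e, c))))
      \<partial>coins k (after_update t X (st w t))) \<le> 1"
    by (simp add: s_def)
qed

text \<open>The factors are 1 outside the interval. For \<open>r = 1 / sqrt N\<close> the terms
  \<open>r\<^sup>2\<close> add up to 1, which explains \<open>b + 1\<close> in place of
  \<open>b\<close>.\<close>

lemma prob_interval_deviation:
  fixes \<Delta> :: "nat \<Rightarrow> (nat \<Rightarrow> day_randomness) \<Rightarrow> real" and b r :: real
  assumes adapted: "\<And>t s w x. t < s \<Longrightarrow> \<Delta> t (w(s := x)) = \<Delta> t w"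
    and step: "\<And>t w. t < T \<Longrightarrow> w \<in> set_pmf (run_pmf t) \<Longrightarrow>
       (\<integral>\<^sup>+x. ennreal (exp (r * \<Delta> t (w(t := x)) - r\<^sup>2)) \<partial>day_pmf t w) \<le> 1"
    and N: "u + N \<le> T" and r: "r = 1 / sqrt (real N)" and "0 < N"
  shows "measure_pmf.prob (run_pmf T) {w. (b + 1) * sqrt (real N) \<le> (\<Sum>j<N. \<Delta> (u + j) w)} \<le> exp (- b)"
proof -
  define H where "H = (\<lambda>t w. if t \<in> {u..<u+N} then exp (r * \<Delta> t w - r\<^sup>2) else 1)"
  have "measure_pmf.prob (run_pmf T) {w. exp b \<le> (\<Prod>t<T. H t w)} \<le> exp (- b)"
  proof (rule prob_ge_le_of_nn_integral_le_1)
    show "(\<integral>\<^sup>+w. ennreal (\<Prod>t<T. H t w) \<partial>run_pmf T) \<le> 1"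
    proof (rule nn_integral_path_pmf_prod_le_1)
      show "(\<integral>\<^sup>+x. ennreal (H t (w(t := x))) \<partial>day_pmf t w) \<le> 1"
        if "t < T" "w \<in> set_pmf (run_pmf t)" for t w
        using step[OF that] by (cases "t \<in> {u..<u+N}") (auto simp: H_def)
    qed (use adapted in \<open>auto simp: H_def\<close>)
  qed (auto intro!: prod_nonneg simp: H_def)
  moreover have sub: "{w. (b + 1) * sqrt (real N) \<le> (\<Sum>j<N. \<Delta> (u + j) w)} \<subseteq> {w. exp b \<le> (\<Prod>t<T. H t w)}"
  proof safe
    fix w assume *: "(b + 1) * sqrt (real N) \<le> (\<Sum>j<N. \<Delta> (u + j) w)"
    have "(\<Prod>t<T. H t w) = (\<Prod>t\<in>{u..<u+N}. exp (r * \<Delta> t w - r\<^sup>2))"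
      using N by (intro prod.mono_neutral_cong_right) (auto simp: H_def)
    also have "\<dots> = (\<Prod>j<N. exp (r * \<Delta> (u + j) w - r\<^sup>2))"
      by (rule prod.reindex_bij_witness[of _ "\<lambda>j. u + j" "\<lambda>t. t - u"]) auto
    also have "\<dots> = exp (r * (\<Sum>j<N. \<Delta> (u + j) w) - r\<^sup>2 * real N)"
      by (simp add: exp_sum[symmetric] sum_subtractf sum_distrib_left mult.commute)
    finally have eq: "(\<Prod>t<T. H t w) = exp (r * (\<Sum>j<N. \<Delta> (u + j) w) - r\<^sup>2 * real N)" .
    have "r\<^sup>2 * real N = 1" using \<open>0 < N\<close> by (simp add: r power_divide)
    moreover have "r * ((b + 1) * sqrt (real N)) \<le> r * (\<Sum>j<N. \<Delta> (u + j) w)"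
      using * by (intro mult_left_mono) (auto simp: r)
    moreover have "r * ((b + 1) * sqrt (real N)) = b + 1" using \<open>0 < N\<close> by (simp add: r)
    ultimately show "exp b \<le> (\<Prod>t<T. H t w)" by (simp add: eq)
  qed
  ultimately show ?thesis
    using measure_pmf.finite_measure_mono[OF sub, of "run_pmf T"] by simp
qed

lemma prob_draws_deviation:
  assumes i: "i < k" and u: "Ts i dvd u" "u < T"
  shows "measure_pmf.prob (run_pmf T)
     {w. (b + 1) * sqrt (real (Ts i)) \<le>
           (\<Sum>j<Ts i. l (u + j) (drawn w (u + j) i)
                      - mean_loss (l (u + j)) (bucket (mid w (u + j)) i))} \<le> exp (- b)"
proof -
  have "1 \<le> Ts i" using Ts_pos[of i] i by simp
  then have r: "1 / sqrt (real (Ts i)) \<le> 1" by simp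
  show ?thesis
    using prob_interval_deviation[of "\<lambda>t w. l t (drawn w t i) - mean_loss (l t) (bucket (mid w t) i)"
        "1 / sqrt (real (Ts i))" u "Ts i" b] draws_step[OF _ _ i r] interval_within_T i u \<open>1 \<le> Ts i\<close>
    by simp
qed

lemma prob_coins_deviation:
  assumes i: "i < k" "0 < i" and u: "Ts i dvd u" "u < T"
  shows "measure_pmf.prob (run_pmf T)
     {w. (b + 1) * sqrt (real (Ts i)) \<le>
           (\<Sum>j<Ts i. l (u + j) (chosen w (u + j) i) - mean_choice_loss w (u + j) i)} \<le> exp (- b)"
proof -
  have "1 \<le> Ts i" using Ts_pos[of i] i by simp
  then have r: "1 / sqrt (real (Ts i)) \<le> 1" by simp
  have "mean_choice_loss (w(s := x)) t i = mean_choice_loss w t i" if "t < s" for t s w x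
    using that by (simp add: mean_choice_loss_def)
  then show ?thesis
    using prob_interval_deviation[of "\<lambda>t w. l t (chosen w t i) - mean_choice_loss w t i"
        "1 / sqrt (real (Ts i))" u "Ts i" b] coins_step[OF _ _ i r] interval_within_T i u \<open>1 \<le> Ts i\<close>
    by simp
qed

end

subsection \<open>Capturing an expert\<close>

text \<open>A miss has probability \<open>1 - 1 / n \<le> exp (- 1 / n)\<close>, so a reward of
  \<open>exp (1 / n)\<close> for it is still a fair or losing bet.\<close>

lemma nn_integral_uniform_miss_le_1:
  fixes x n :: nat
  assumes "x < n"
  shows "(\<integral>\<^sup>+y. ennreal (if y = x then 0 else exp (1 / real n)) \<partial>pmf_of_set {..<n}) \<le> 1"
proof -
  have ne: "{..<n} \<noteq> {}" using assms by auto
  have n: "0 < real n" using assms by simp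
  have "(\<integral>\<^sup>+y. ennreal (if y = x then 0 else exp (1 / real n)) \<partial>pmf_of_set {..<n})
      = (\<Sum>y<n. ennreal (if y = x then 0 else exp (1 / real n))) / of_nat (card {..<n})"
    using ne by (subst nn_integral_pmf_of_set) auto
  also have "(\<Sum>y<n. ennreal (if y = x then 0 else exp (1 / real n)))
      = ennreal (\<Sum>y<n. if y = x then 0 else exp (1 / real n))"
    by (rule sum_ennreal) auto
  also have "(\<Sum>y<n. if y = x then 0 else exp (1 / real n)) = (real n - 1) * exp (1 / real n)"
  proof -
    have "(\<Sum>y<n. if y = x then 0 else exp (1 / real n)) = (\<Sum>y\<in>{..<n} - {x}. exp (1 / real n))"
      by (intro sum.mono_neutral_cong_right) auto
    also have "\<dots> = (real n - 1) * exp (1 / real n)" using assms by (simp add: of_nat_diff)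
    finally show ?thesis .
  qed
  also have "ennreal ((real n - 1) * exp (1 / real n)) / of_nat (card {..<n})
      = ennreal ((real n - 1) * exp (1 / real n) / real n)"
    using assms by (simp add: divide_ennreal ennreal_of_nat_eq_real_of_nat)
  also have "(real n - 1) * exp (1 / real n) / real n = (1 - 1 / real n) * exp (1 / real n)"
    using n by (simp add: field_simps)
  also have "\<dots> \<le> exp (- 1 / real n) * exp (1 / real n)"
    using exp_ge_add_one_self[of "- 1 / real n"] by (intro mult_right_mono) auto
  also have "\<dots> = 1" by (simp flip: exp_add)
  finally show ?thesis by (simp add: ennreal_leI flip: ennreal_1)
qed

text \<open>
  The condition \<open>V j\<close> may depend on the outcomes of rank below that of \<open>j\<close>, so revealing the
  outcomes by increasing rank turns the product into a supermartingale.
\<close>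

lemma nn_integral_ranked_misses_le_1:
  fixes x n :: nat and rank :: "nat \<Rightarrow> real" and V :: "nat \<Rightarrow> (nat \<times> real) set \<Rightarrow> bool"
  assumes x: "x < n" and fin: "finite J" and inj: "inj_on rank J"
  shows "(\<integral>\<^sup>+f. ennreal (\<Prod>j\<in>J. if V j {(f j', rank j') |j'. j' \<in> J \<and> rank j' < rank j}
                                   then (if f j = x then 0 else exp (1 / real n)) else 1)
           \<partial>Pi_pmf J d (\<lambda>_. pmf_of_set {..<n})) \<le> 1"
  using fin inj
proof (induction J rule: finite_ranking_induct[where f = rank])
  case (insert z S)
  show ?case
  proof (cases "z \<in> S")
    case True
    then show ?thesis using insert by (simp add: insert_absorb)
  next
    case False
    define A where "A = (\<lambda>J f j. {(f j', rank j') |j'. j' \<in> J \<and> rank j' < rank j}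
                        :: (nat \<times> real) set)"
    define h where "h = (\<lambda>(y::nat) b. if b then (if y = x then 0 else exp (1 / real n)) else 1)"
    \<comment> \<open>The induction inserts the slots by increasing rank: \<open>z\<close> comes
      last, so its outcome enters no condition, not even its own.\<close>
    have less: "rank j < rank z" if "j \<in> S" for j
      using insert.hyps(2)[OF that] insert.prems that False
      by (metis inj_on_def insertI1 insertI2 order_le_less)
    have A1: "A (insert z S) (f(z := y)) j = A S f j" if "j \<in> S" for f y j
      using less[OF that] False by (fastforce simp: A_def)
    have A2: "A (insert z S) (f(z := y)) z = A S f z" for f y
      using False by (fastforce simp: A_def)
    have prod: "(\<Prod>j\<in>insert z S. h ((f(z := y)) j) (V j (A (insert z S) (f(z := y)) j)))
        = (\<Prod>j\<in>S. h (f j) (V j (A S f j))) * h y (V z (A S f z))" for f y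
    proof -
      have "(\<Prod>j\<in>S. h ((f(z := y)) j) (V j (A (insert z S) (f(z := y)) j)))
          = (\<Prod>j\<in>S. h (f j) (V j (A S f j)))"
        using False A1 by (intro prod.cong) auto
      then show ?thesis using insert.hyps(1) False by (simp add: A2 mult.commute)
    qed
    have h0: "0 \<le> h y b" for y b by (simp add: h_def)
    have step: "(\<integral>\<^sup>+y. ennreal (h y b) \<partial>pmf_of_set {..<n}) \<le> 1" for b
      using nn_integral_uniform_miss_le_1[OF x] by (cases b) (simp_all add: h_def)
    have "(\<integral>\<^sup>+f. ennreal (\<Prod>j\<in>insert z S. h (f j) (V j (A (insert z S) f j)))
            \<partial>Pi_pmf (insert z S) d (\<lambda>_. pmf_of_set {..<n}))
        = (\<integral>\<^sup>+f. (\<integral>\<^sup>+y. ennreal (\<Prod>j\<in>S. h (f j) (V j (A S f j))) * ennreal (h y (V z (A S f z)))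
             \<partial>pmf_of_set {..<n}) \<partial>Pi_pmf S d (\<lambda>_. pmf_of_set {..<n}))"
      using insert.hyps(1) False
      by (subst Pi_pmf_insert', simp, simp, subst bind_commute_pmf)
         (simp add: prod h0 prod_nonneg ennreal_mult del: fun_upd_apply prod.insert)
    also have "\<dots> = (\<integral>\<^sup>+f. ennreal (\<Prod>j\<in>S. h (f j) (V j (A S f j)))
          * (\<integral>\<^sup>+y. ennreal (h y (V z (A S f z))) \<partial>pmf_of_set {..<n})
             \<partial>Pi_pmf S d (\<lambda>_. pmf_of_set {..<n}))"
      by (simp add: nn_integral_cmult)
    also have "\<dots> \<le> (\<integral>\<^sup>+f. ennreal (\<Prod>j\<in>S. h (f j) (V j (A S f j))) * 1
             \<partial>Pi_pmf S d (\<lambda>_. pmf_of_set {..<n}))"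
      by (intro nn_integral_mono mult_left_mono step) auto
    also have "\<dots> \<le> 1"
      using insert.IH insert.prems by (simp add: A_def h_def inj_on_insert)
    finally show ?thesis by (simp add: A_def h_def)
  qed
qed simp

context hierarchy
begin

section \<open>Keys and hypothetical survival\<close>

text \<open>Expert and arrival time determine the accumulated loss, and eviction ignores weights. So
  the evictions can be followed on these pairs alone, without regard to draws and coins.\<close>

definition key :: "entry \<Rightarrow> nat \<times> real" where
  "key E = (expert E, arrival E)"

definition keys :: "(nat \<Rightarrow> day_randomness) \<Rightarrow> nat \<Rightarrow> nat \<Rightarrow> (nat \<times> real) set" where
  "keys w t i = key ` set (bucket (mid w t) i)"

definition key_loss :: "nat \<Rightarrow> nat \<times> real \<Rightarrow> real" where
  "key_loss t q = (\<Sum>d\<in>{nat \<lfloor>snd q\<rfloor>..<t}. l d (fst q))"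

definition key_dominates :: "nat \<Rightarrow> nat \<times> real \<Rightarrow> nat \<times> real \<Rightarrow> bool" where
  "key_dominates t q' q \<longleftrightarrow> snd q' < snd q \<and> key_loss t q' \<le> (1 + \<epsilon>) * key_loss t q"

definition survivors :: "nat \<Rightarrow> (nat \<times> real) set \<Rightarrow> (nat \<times> real) set" where
  "survivors t S = {q \<in> S. \<not> (real (\<tau> t) + 1/2 \<le> snd q \<and> (\<exists>q'\<in>S. key_dominates t q' q))}"

text \<open>The keys of \<open>S\<close> that are left after \<open>d\<close> days, if nothing is added to the bucket.\<close>

primrec evolve :: "nat \<Rightarrow> nat \<Rightarrow> (nat \<times> real) set \<Rightarrow> nat \<Rightarrow> (nat \<times> real) set" where
  "evolve i t S 0 = S"
| "evolve i t S (Suc d) =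
     (if Ts i dvd t + Suc d then survivors (t + Suc d) (evolve i t S d) else evolve i t S d)"

text \<open>
  Would a copy of expert \<open>x\<close> in the \<open>j\<close>-th sample slot at \<open>t\<close> stay in bucket \<open>i\<close> until the end?
  Evictions are caused by earlier arrivals only, so the answer depends neither on the later
  randomness nor on the expert actually sampled into the slot.
\<close>

definition would_survive :: "nat \<Rightarrow> nat \<Rightarrow> (nat \<Rightarrow> day_randomness) \<Rightarrow> nat \<Rightarrow> nat \<Rightarrow> bool" where
  "would_survive x i w t j \<longleftrightarrow>
     (let q = (x, smp t i j); S = {q' \<in> keys w t i. snd q' < snd q} in
      \<not> (\<exists>d. t + Suc d < T \<and> Ts i dvd t + Suc d \<and> real (\<tau> (t + Suc d)) + 1/2 \<le> snd q \<and>
            (\<exists>q'\<in>evolve i t S d. key_dominates (t + Suc d) q' q)))"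

definition captured :: "nat \<Rightarrow> nat \<Rightarrow> (nat \<Rightarrow> day_randomness) \<Rightarrow> nat \<Rightarrow> bool" where
  "captured x i w t \<longleftrightarrow> (\<exists>t'\<le>t. Ts i dvd t' \<and> (\<exists>j<m. would_survive x i w t' j \<and> fst (w t') i ! j = x))"

definition bad :: "nat \<Rightarrow> nat \<Rightarrow> (nat \<Rightarrow> day_randomness) \<Rightarrow> nat \<Rightarrow> bool" where
  "bad x i w t \<longleftrightarrow> \<not> captured x i w t \<and> (\<forall>j<m. would_survive x i w t j)"

text \<open>A capture contributes the factor 0 and would annihilate the product for good. The
  cut-off \<open>d\<close> allows stopping just after a bad time, before which no capture has
  happened.\<close>

definition miss_factor :: "nat \<Rightarrow> nat \<Rightarrow> nat \<Rightarrow> nat \<Rightarrow> (nat \<Rightarrow> day_randomness) \<Rightarrow> real" where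
  "miss_factor x i d t w =
     (if Ts i dvd t \<and> t < d
      then \<Prod>j<m. if would_survive x i w t j
                   then (if fst (w t) i ! j = x then 0 else exp (1 / real n)) else 1
      else 1)"

lemma keys_upd: "t < s \<Longrightarrow> keys (w(s := y)) t i = keys w t i"
  by (simp add: keys_def)

lemma miss_factor_upd: "t < s \<Longrightarrow> miss_factor x i d t (w(s := y)) = miss_factor x i d t w"
  by (auto simp: miss_factor_def would_survive_def keys_upd Let_def intro!: prod.cong)

lemma key_image_new_entries: "key ` set (new_entries a xs) = {(xs ! j, a j) |j. j < length xs}"
  by (force simp: new_entries_def key_def)

lemma miss_factor_step:
  assumes x: "x < n" and i: "i < k"
  shows "(\<integral>\<^sup>+y. ennreal (miss_factor x i d t (w(t := y))) \<partial>day_pmf t w) \<le> 1"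
proof (cases "Ts i dvd t \<and> t < d")
  case False
  then have "miss_factor x i d t w' = 1" for w' by (auto simp: miss_factor_def)
  then show ?thesis by simp
next
  case True
  \<comment> \<open>\<open>Old\<close> collects the kept and forwarded entries, which do not depend
    on the samples of the day. \<open>V\<close> then expresses survival through the outcomes
    \<open>S'\<close> of those slots of the day that arrive earlier, as the ranked revelation
    demands.\<close>
  define Old where "Old = key ` set (kept w t i @
     new_entries (fwd t i (length (forwarded w t i))) (forwarded w t i))"
  define V where "V = (\<lambda>j S'. let q = (x, smp t i j); S = {q' \<in> Old. snd q' < snd q} \<union> S' in
      \<not> (\<exists>d. t + Suc d < T \<and> Ts i dvd t + Suc d \<and> real (\<tau> (t + Suc d)) + 1/2 \<le> snd q \<and>
            (\<exists>q'\<in>evolve i t S d. key_dominates (t + Suc d) q' q)))"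
  define G where "G = (\<lambda>f. \<Prod>j<m. if V j {(f j', smp t i j') |j'. j' \<in> {..<m} \<and> smp t i j' < smp t i j}
                                   then (if f j = x then 0 else exp (1 / real n)) else (1::real))"
  have t0: "Ts 0 dvd t" using True i Ts0_dvd by blast
  then have le: "i \<le> update_level k Ts t" using le_update_level_iff i True by blast
  have MF: "miss_factor x i d t (w(t := (X, e, c))) = G (\<lambda>j. X i ! j)"
    if X: "length (X i) = m" for X e c
  proof -
    have kf: "kept (w(t := (X, e, c))) t = kept w t" by (rule ext) (simp add: kept_def)
    then have fw: "forwarded (w(t := (X, e, c))) t i = forwarded w t i"
      by (simp add: forwarded_def)
    have "keys (w(t := (X, e, c))) t i = Old \<union> {(X i ! j', smp t i j') |j'. j' < m}"
      using True X
      by (simp add: keys_def bucket_mid[OF i] kf fw image_Un key_image_new_entries Old_def Un_assoc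
          del: mid_upd_same)
    then have "{q' \<in> keys (w(t := (X, e, c))) t i. snd q' < smp t i j}
        = {q' \<in> Old. snd q' < smp t i j}
          \<union> {(X i ! j', smp t i j') |j'. j' \<in> {..<m} \<and> smp t i j' < smp t i j}" for j
      by auto
    then have "would_survive x i (w(t := (X, e, c))) t j
        = V j {(X i ! j', smp t i j') |j'. j' \<in> {..<m} \<and> smp t i j' < smp t i j}" for j
      by (simp add: would_survive_def V_def Let_def)
    then show ?thesis using True by (auto simp: miss_factor_def G_def intro!: prod.cong)
  qed
  have marginal: "map_pmf (\<lambda>X. X i) (sample_pmf t)
      = map_pmf (\<lambda>f. map f [0..<m]) (Pi_pmf {..<m} 0 (\<lambda>_. pmf_of_set {..<n}))"
    using t0 le by (simp add: sample_pmf_def Pi_pmf_component flip: replicate_pmf_conv_Pi_pmf)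
  have "(\<integral>\<^sup>+y. ennreal (miss_factor x i d t (w(t := y))) \<partial>day_pmf t w)
      = (\<integral>\<^sup>+X. (\<integral>\<^sup>+e. (\<integral>\<^sup>+c. ennreal (miss_factor x i d t (w(t := (X, e, c))))
           \<partial>coins k (after_update t X (st w t)))
           \<partial>draws k (after_update t X (st w t))) \<partial>sample_pmf t)"
    by (simp add: day_pmf_def)
  also have "\<dots> = (\<integral>\<^sup>+X. ennreal (G (\<lambda>j. X i ! j)) \<partial>sample_pmf t)"
  proof (intro nn_integral_cong_AE AE_pmfI)
    fix X assume "X \<in> set_pmf (sample_pmf t)"
    then have "length (X i) = m" using set_pmf_sample_pmf i True by blast
    then show "(\<integral>\<^sup>+e. (\<integral>\<^sup>+c. ennreal (miss_factor x i d t (w(t := (X, e, c))))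
           \<partial>coins k (after_update t X (st w t)))
           \<partial>draws k (after_update t X (st w t))) = ennreal (G (\<lambda>j. X i ! j))"
      by (simp add: MF)
  qed
  also have "\<dots> = (\<integral>\<^sup>+xs. ennreal (G (\<lambda>j. xs ! j)) \<partial>map_pmf (\<lambda>X. X i) (sample_pmf t))" by simp
  also have "\<dots> = (\<integral>\<^sup>+f. ennreal (G (\<lambda>j. map f [0..<m] ! j)) \<partial>Pi_pmf {..<m} 0 (\<lambda>_. pmf_of_set {..<n}))"
    unfolding marginal by simp
  also have "\<dots> = (\<integral>\<^sup>+f. ennreal (G f) \<partial>Pi_pmf {..<m} 0 (\<lambda>_. pmf_of_set {..<n}))"
  proof (intro nn_integral_cong arg_cong[where f = ennreal])
    fix f :: "nat \<Rightarrow> nat"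
    have "{(map f [0..<m] ! j', smp t i j') |j'. j' \<in> {..<m} \<and> smp t i j' < smp t i j}
        = {(f j', smp t i j') |j'. j' \<in> {..<m} \<and> smp t i j' < smp t i j}" for j
      by (intro Collect_cong ex_cong1) auto
    then show "G (\<lambda>j. map f [0..<m] ! j) = G f" unfolding G_def by (intro prod.cong) auto
  qed
  also have "\<dots> \<le> 1"
    unfolding G_def by (rule nn_integral_ranked_misses_le_1) (use x smp_inj in auto)
  finally show ?thesis .
qed

section \<open>The number of bad times\<close>

lemma prob_misses:
  assumes "x < n" "i < k"
  shows "measure_pmf.prob (run_pmf T) {w. exp b \<le> (\<Prod>t<T. miss_factor x i d t w)} \<le> exp (- b)"
proof (rule prob_ge_le_of_nn_integral_le_1)
  show "0 \<le> (\<Prod>t<T. miss_factor x i d t w)" for w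
    by (intro prod_nonneg) (auto simp: miss_factor_def intro!: prod_nonneg)
  show "(\<integral>\<^sup>+w. ennreal (\<Prod>t<T. miss_factor x i d t w) \<partial>run_pmf T) \<le> 1"
    using miss_factor_step[OF assms] miss_factor_upd
    by (intro nn_integral_path_pmf_prod_le_1) (auto simp: miss_factor_def intro!: prod_nonneg)
qed

text \<open>Up to the last bad time nothing is captured, so no factor is below 1, and each bad time
  contributes \<open>m\<close> factors \<open>exp (1 / n)\<close>.\<close>

lemma card_bad_le:
  assumes b: "0 \<le> b" and less: "\<And>d. d \<le> T \<Longrightarrow> (\<Prod>t<T. miss_factor x i d t w) < exp b"
  defines "A \<equiv> {t. t < T \<and> Ts i dvd t \<and> bad x i w t}"
  shows "real m * real (card A) \<le> real n * b"
proof (cases "A = {}")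
  case True
  then show ?thesis using b by simp
next
  case False
  have fin: "finite A" by (simp add: A_def)
  \<comment> \<open>This cut-off depends on the path, which is admissible because
    \<open>less\<close> covers every \<open>d \<le> T\<close>.\<close>
  define d where "d = Suc (Max A)"
  have max: "Max A \<in> A" using fin False by simp
  then have nc: "\<not> captured x i w (Max A)" and d: "d \<le> T" by (auto simp: A_def bad_def d_def)
  have miss: "fst (w t) i ! j \<noteq> x" if "t < d" "Ts i dvd t" "would_survive x i w t j" "j < m" for t j
    using nc that by (auto simp: captured_def d_def)
  have ge1: "1 \<le> miss_factor x i d t w" for t
    using miss by (auto simp: miss_factor_def intro!: prod_ge_1)
  have mem: "miss_factor x i d t w = exp (real m / real n)" if "t \<in> A" for t
  proof -
    have t: "t < d" "Ts i dvd t" "\<And>j. j < m \<Longrightarrow> would_survive x i w t j"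
      using that fin by (auto simp: A_def bad_def d_def less_Suc_eq_le)
    have "miss_factor x i d t w = (\<Prod>j<m. exp (1 / real n))"
      using t miss by (simp add: miss_factor_def)
    then show ?thesis by (simp flip: exp_of_nat_mult)
  qed
  have "exp (real (card A) * (real m / real n)) = (\<Prod>t\<in>A. miss_factor x i d t w)"
    by (simp add: mem flip: exp_of_nat_mult)
  also have "\<dots> \<le> (\<Prod>t<T. miss_factor x i d t w)"
    by (intro prod_mono2) (use ge1 order_trans[OF zero_le_one ge1] in \<open>auto simp: A_def\<close>)
  also have "\<dots> < exp b" using less d by blast
  finally have "real (card A) * (real m / real n) < b" by simp
  then show ?thesis using n_pos by (simp add: field_simps)
qed

section \<open>The keys of a bucket over time\<close>

lemma keys_kept:
  assumes "samples_ok w d" "t \<le> d" "i < k"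
  shows "key ` set (kept w t i) = survivors t (key ` set (bucket (st w t) i))"
proof -
  have loss: "loss E = key_loss t (key E)" if "E \<in> set (bucket (st w t) i)" for E
    using st_entries_ok[OF assms that] by (simp add: entry_ok_def key_loss_def key_def)
  have dom: "dominates \<epsilon> E' E \<longleftrightarrow> key_dominates t (key E') (key E)"
    if "E \<in> set (bucket (st w t) i)" "E' \<in> set (bucket (st w t) i)" for E E'
    using loss[OF that(1)] loss[OF that(2)]
    by (simp add: dominates_def key_dominates_def) (simp add: key_def)
  have "key ` set (kept w t i) = key ` set (evict \<epsilon> (\<tau> t) (bucket (st w t) i))"
    by (simp add: kept_def image_image key_def)
  also have "\<dots> = survivors t (key ` set (bucket (st w t) i))"
    using dom by (auto simp: evict_def survivors_def key_def[of "_ :: entry"] image_iff)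
  finally show ?thesis .
qed

lemma keys_st_Suc: "key ` set (bucket (st w (Suc t)) i) = keys w t i"
  by (simp add: bucket_st_Suc keys_def image_image key_def del: st.simps)

lemma keys_Suc:
  assumes w: "samples_ok w T" and t: "Suc t < T" and i: "i < k"
  obtains N where "\<And>q. q \<in> N \<Longrightarrow> real (Suc t) \<le> snd q"
    "keys w (Suc t) i
       = (if Ts i dvd Suc t then survivors (Suc t) (keys w t i) \<union> N else keys w t i)"
proof (cases "Ts i dvd Suc t")
  case False
  then have "keys w (Suc t) i = keys w t i"
    using i by (simp add: keys_def[of w "Suc t"] bucket_mid keys_st_Suc del: st.simps)
  then show ?thesis using that[of "{}"] False by simp
next
  case True
  define fw where "fw = forwarded w (Suc t) i"
  define N where "N = key ` set (new_entries (fwd (Suc t) i (length fw)) fw)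
                    \<union> key ` set (new_entries (smp (Suc t) i) (fst (w (Suc t)) i))"
  have len: "length (fst (w (Suc t)) i) = m" using w t i True by (simp add: samples_ok_def)
  have "real (Suc t) \<le> snd q" if "q \<in> N" for q
    using that fwd_bounds[of _ "length fw" "Suc t" i] smp_bounds[of _ "Suc t" i] len
    unfolding N_def key_image_new_entries by force
  moreover have "keys w (Suc t) i = survivors (Suc t) (keys w t i) \<union> N"
    using i True keys_kept[OF w _ i, of "Suc t"] t keys_st_Suc
    by (simp add: keys_def[of w "Suc t"] bucket_mid image_Un N_def fw_def Un_assoc del: st.simps)
  ultimately show ?thesis using that[of N] True by simp
qed

text \<open>Domination requires an earlier arrival, so eviction acts on an initial segment of the
  arrival times without looking beyond it.\<close>

lemma survivors_below:
  "{q \<in> survivors t S. snd q < a} = survivors t {q \<in> S. snd q < a}"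
  by (auto simp: survivors_def key_dominates_def)

text \<open>Entries added after day \<open>t\<close> arrive at \<open>t + 1\<close> or later, hence
  not before \<open>a\<close>; the rest is that truncation commutes with eviction.\<close>

lemma keys_below:
  assumes w: "samples_ok w T" and i: "i < k" and a: "a \<le> real t + 1" and d: "t + d < T"
  shows "{q \<in> keys w (t + d) i. snd q < a} = evolve i t {q \<in> keys w t i. snd q < a} d"
  using d
proof (induction d)
  case (Suc d)
  from Suc.prems obtain N where N: "\<And>q. q \<in> N \<Longrightarrow> real (Suc (t + d)) \<le> snd q"
    "keys w (Suc (t + d)) i
       = (if Ts i dvd Suc (t + d) then survivors (Suc (t + d)) (keys w (t + d) i) \<union> N
          else keys w (t + d) i)"
    using keys_Suc[OF w _ i, of "t + d"] by auto
  have "{q \<in> N. snd q < a} = {}" using N(1) a by fastforce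
  then have "{q \<in> keys w (Suc (t + d)) i. snd q < a}
     = (if Ts i dvd Suc (t + d) then survivors (Suc (t + d)) {q \<in> keys w (t + d) i. snd q < a}
        else {q \<in> keys w (t + d) i. snd q < a})"
    unfolding N(2) survivors_below[symmetric] by auto
  then show ?case using Suc by simp
qed simp

lemma evolve_antimono: "e \<le> d \<Longrightarrow> evolve i t S d \<subseteq> evolve i t S e"
  by (induction d rule: dec_induct) (auto simp: survivors_def)

text \<open>
  At a time that is not bad, either \<open>x\<close> itself is in the bucket for good, or the evictor of some
  hypothetical copy of \<open>x\<close> does almost as well as \<open>x\<close> until the eviction.
\<close>

lemma not_bad_jump:
  assumes w: "samples_ok w T" and t: "t < T" and i: "i < k" "Ts i dvd t" and x: "x < n"
    and nb: "\<not> bad x i w t"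
  obtains t' y a where "t < t'" "t' \<le> T" "Ts i dvd t'" "t' = T \<or> \<tau> t' \<le> t" "a < real t + 1"
    "\<And>v. t \<le> v \<Longrightarrow> v < t' \<Longrightarrow> (y, a) \<in> keys w v i"
    "(\<Sum>d\<in>{t..<t'}. l d y) \<le> (1 + \<epsilon>) * (\<Sum>d\<in>{t..<t'}. l d x)"
proof (cases "captured x i w t")
  case True
  have "0 \<le> \<epsilon>" using t T_eq by (simp add: \<epsilon>_def)
  from True obtain s j where s: "s \<le> t" "Ts i dvd s" "j < m" "would_survive x i w s j"
      "fst (w s) i ! j = x" by (auto simp: captured_def)
  define q where "q = (x, smp s i j)"
  have persist: "q \<in> keys w (s + d) i" if "s + d < T" for d
    using that
  proof (induction d)
    case 0
    then have "length (fst (w s) i) = m" using w i s by (simp add: samples_ok_def)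
    then show ?case using s i
      by (auto simp: keys_def bucket_mid image_Un key_image_new_entries q_def)
  next
    case (Suc d)
    have "Suc (s + d) < T" using Suc.prems by simp
    then obtain N where N: "keys w (Suc (s + d)) i
         = (if Ts i dvd Suc (s + d) then survivors (Suc (s + d)) (keys w (s + d) i) \<union> N
            else keys w (s + d) i)"
      using keys_Suc[OF w _ i(1)] by metis
    have a: "smp s i j \<le> real s + 1" using smp_bounds[of j s i] s(3) by simp
    \<comment> \<open>An actual evictor of \<open>q\<close> arrives earlier than \<open>q\<close>,
      so it also occurs in the hypothetical evolution, where \<open>would_survive\<close> excludes
      it.\<close>
    have "\<not> (real (\<tau> (Suc (s + d))) + 1/2 \<le> snd q
             \<and> (\<exists>q'\<in>keys w (s + d) i. key_dominates (Suc (s + d)) q' q))"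
      if "Ts i dvd Suc (s + d)"
    proof safe
      fix q' assume q': "real (\<tau> (Suc (s + d))) + 1/2 \<le> snd q" "q' \<in> keys w (s + d) i"
        "key_dominates (Suc (s + d)) q' q"
      then have "q' \<in> evolve i s {q \<in> keys w s i. snd q < smp s i j} d"
        using keys_below[OF w i(1) a, of d] Suc.prems by (auto simp: key_dominates_def q_def)
      then show False using s(4) q' that Suc.prems by (auto simp: would_survive_def q_def)
    qed
    then show ?case using Suc by (simp add: N survivors_def)
  qed
  show ?thesis
  proof (rule that[of T "smp s i j" x])
    show "smp s i j < real t + 1" using smp_bounds[of j s i] s by linarith
    show "(x, smp s i j) \<in> keys w v i" if "t \<le> v" "v < T" for v
      using persist[of "v - s"] that s by (simp add: q_def)
    have "0 \<le> (\<Sum>d\<in>{t..<T}. l d x)" using loss_bounds x by (intro sum_nonneg) auto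
    then show "(\<Sum>d\<in>{t..<T}. l d x) \<le> (1 + \<epsilon>) * (\<Sum>d\<in>{t..<T}. l d x)"
      using \<open>0 \<le> \<epsilon>\<close> by (simp add: distrib_right)
  qed (use t Ts_dvd_T i in auto)
next
  case False
  with nb obtain j where j: "j < m" "\<not> would_survive x i w t j" by (auto simp: bad_def)
  define q where "q = (x, smp t i j)"
  from j obtain d q' where d: "t + Suc d < T" "Ts i dvd t + Suc d"
      "real (\<tau> (t + Suc d)) + 1/2 \<le> smp t i j"
      "q' \<in> evolve i t {q \<in> keys w t i. snd q < smp t i j} d" "key_dominates (t + Suc d) q' q"
    by (auto simp: would_survive_def q_def)
  have a: "smp t i j < real t + 1" "real t + 1/2 \<le> smp t i j" using smp_bounds[OF j(1)] by auto
  have in_keys: "q' \<in> keys w (t + e) i \<and> snd q' < smp t i j" if "e \<le> d" for e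
  proof -
    have "q' \<in> evolve i t {q \<in> keys w t i. snd q < smp t i j} e"
      using evolve_antimono[OF that] d(4) by blast
    then show ?thesis using keys_below[OF w i(1) less_imp_le[OF a(1)], of e] that d(1) by auto
  qed
  show ?thesis
  proof (rule that[of "t + Suc d" "snd q'" "fst q'"])
    \<comment> \<open>From \<open>\<tau> (t + Suc d) + 1/2 \<le> smp t i j < t + 1\<close>, since
      \<tau> is an integer.\<close>
    show "t + Suc d = T \<or> \<tau> (t + Suc d) \<le> t" using d(3) a by linarith
    show "snd q' < real t + 1" using in_keys[of 0] a by simp
    show "(fst q', snd q') \<in> keys w v i" if "t \<le> v" "v < t + Suc d" for v
      using in_keys[of "v - t"] that by simp
    have "fst q' < n"
      using in_keys[of 0] mid_entries_ok[OF w t i(1)] by (auto simp: keys_def key_def entry_ok_def)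
    moreover have "nat \<lfloor>snd q'\<rfloor> \<le> t" using in_keys[of 0] a by linarith
    \<comment> \<open>The evictor may have arrived before \<open>t\<close>; its earlier losses are
      nonnegative, so dropping them is harmless. The copy of \<open>x\<close>, in contrast, arrives
      on day \<open>t\<close> itself.\<close>
    ultimately have "(\<Sum>d\<in>{t..<t + Suc d}. l d (fst q')) \<le> key_loss (t + Suc d) q'"
      unfolding key_loss_def using d(1) loss_bounds by (intro sum_mono2) auto
    also have "\<dots> \<le> (1 + \<epsilon>) * key_loss (t + Suc d) q" using d(5) by (simp add: key_dominates_def)
    also have "nat \<lfloor>smp t i j\<rfloor> = t" using a by linarith
    then have "key_loss (t + Suc d) q = (\<Sum>d\<in>{t..<t + Suc d}. l d x)"
      by (simp add: key_loss_def q_def)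
    finally show "(\<Sum>d\<in>{t..<t + Suc d}. l d (fst q')) \<le> (1 + \<epsilon>) * (\<Sum>d\<in>{t..<t + Suc d}. l d x)" .
  qed (use d in auto)
qed

end

subsection \<open>Covering the days and charging the levels\<close>

lemma dvd_add_le:
  fixes N a b :: nat
  assumes "N dvd a" "N dvd b" "a < b"
  shows "a + N \<le> b"
proof -
  obtain p q where "a = N * p" "b = N * q" using assms by (auto elim!: dvdE)
  moreover from this assms(3) have "p < q" by auto
  then have "N * Suc p \<le> N * q" by (intro mult_left_mono) auto
  ultimately show ?thesis by simp
qed

lemma sum_le_of_blocks:
  fixes f h :: "nat \<Rightarrow> real"
  assumes "\<And>b. b < q \<Longrightarrow> sum f {u + b * N..<u + b * N + N} \<le> sum h {u + b * N..<u + b * N + N}"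
  shows "sum f {u..<u + q * N} \<le> sum h {u..<u + q * N}"
  using assms
proof (induction q)
  case (Suc q)
  have split: "sum g {u..<u + Suc q * N}
      = sum g {u..<u + q * N} + sum g {u + q * N..<u + q * N + N}" for g :: "nat \<Rightarrow> real"
    by (subst sum.atLeastLessThan_concat) (auto simp: algebra_simps)
  show ?case using Suc.IH Suc.prems[of q] Suc.prems unfolding split by (intro add_mono) auto
qed simp

lemma sum_lessThan_shift:
  fixes f :: "nat \<Rightarrow> real"
  shows "(\<Sum>j<N. f (u + j)) = sum f {u..<u + N}"
  by (rule sum.reindex_bij_witness[of _ "\<lambda>t. t - u" "\<lambda>j. u + j"]) auto

context hierarchy
begin

text \<open>An entry that is there after the update but arrived before \<open>u\<close> was kept,
  hence is among those forwarded. Its copy gets a new arrival time, so only the expert carries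
  over.\<close>

lemma key_forwarded:
  assumes i: "i < j" "j < k" and u: "Ts j dvd u" and q: "q \<in> keys w u i" "snd q < real u"
    and w: "samples_ok w T" "u < T"
  shows "fst q \<in> fst ` keys w u j"
proof -
  have ui: "Ts i dvd u" using Ts_dvd[of i j] u i dvd_trans by auto
  have i': "i < k" using i by simp
  have len: "length (fst (w u) i) = m" using w i' ui by (simp add: samples_ok_def)
  have "q \<notin> key ` set (new_entries (smp u i) (fst (w u) i))"
    using q(2) smp_bounds[of _ u i] len unfolding key_image_new_entries by force
  moreover have "q \<notin> key ` set (new_entries (fwd u i (length (forwarded w u i))) (forwarded w u i))"
    using q(2) fwd_bounds[of _ "length (forwarded w u i)" u i]
    unfolding key_image_new_entries by force
  ultimately have "q \<in> key ` set (kept w u i)"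
    using q(1) ui unfolding keys_def bucket_mid[OF i'] by (auto simp: image_Un)
  then have "fst q \<in> set (forwarded w u j)" using i by (force simp: forwarded_def key_def)
  then have "fst q \<in> fst ` key ` set (new_entries (fwd u j (length (forwarded w u j))) (forwarded w u j))"
    unfolding key_image_new_entries in_set_conv_nth
    by (smt (verit, best) fst_conv image_iff mem_Collect_eq)
  then show ?thesis using u i by (auto simp: keys_def bucket_mid)
qed

section \<open>A comparator assembled from jumps\<close>

definition tracked :: "(nat \<Rightarrow> day_randomness) \<Rightarrow> (nat \<Rightarrow> nat) \<Rightarrow> nat \<Rightarrow> nat \<Rightarrow> bool" where
  "tracked w c i v \<longleftrightarrow> i < k \<and> Ts i dvd v \<and> (\<exists>y\<in>fst ` keys w v i. \<forall>d\<in>{v..<v + Ts i}. c d = y)"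

text \<open>The invariant of the covering. Its last conjunct speaks of every level separately
  because the charging needs this: an interval of level \<open>j\<close> that no tracked interval
  covers starts at a bad time of that very level.\<close>

definition comparator :: "nat \<Rightarrow> (nat \<Rightarrow> day_randomness) \<Rightarrow> nat \<Rightarrow> (nat \<Rightarrow> nat) \<Rightarrow> bool" where
  "comparator x w t c \<longleftrightarrow>
     (\<Sum>d<t. l d (c d)) \<le> (1 + \<epsilon>) * (\<Sum>d<t. l d x) \<and> (\<forall>d<t. c d < n) \<and>
     (\<forall>j<k. \<forall>u<t. Ts j dvd u \<longrightarrow> bad x j w u \<or>
        (\<exists>i v. j \<le> i \<and> v \<le> u \<and> u < v + Ts i \<and> v + Ts i \<le> t \<and> tracked w c i v))"

lemma comparator_extend:
  assumes c: "comparator x w t c" and t': "t < t'" "t' \<le> T" and y: "y < n"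
    and loss: "(\<Sum>d\<in>{t..<t'}. l d y) \<le> (1 + \<epsilon>) * (\<Sum>d\<in>{t..<t'}. l d x)"
    and new: "\<And>j u. j < k \<Longrightarrow> t \<le> u \<Longrightarrow> u < t' \<Longrightarrow> Ts j dvd u \<Longrightarrow> bad x j w u \<or>
        (\<exists>i v. i < k \<and> j \<le> i \<and> Ts i dvd v \<and> t \<le> v \<and> v \<le> u \<and> u < v + Ts i \<and> v + Ts i \<le> t' \<and>
               y \<in> fst ` keys w v i)"
  shows "\<exists>c'. comparator x w t' c'"
proof
  define c' where "c' = (\<lambda>d. if d < t then c d else y)"
  have split: "sum f {..<t'} = sum f {..<t} + sum f {t..<t'}" for f :: "nat \<Rightarrow> real"
    using t' by (simp add: sum.atLeastLessThan_concat lessThan_atLeast0)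
  have "(\<Sum>d<t'. l d (c' d)) = (\<Sum>d<t. l d (c d)) + (\<Sum>d\<in>{t..<t'}. l d y)"
    unfolding split by (intro arg_cong2[where f = "(+)"] sum.cong) (auto simp: c'_def)
  also have "\<dots> \<le> (1 + \<epsilon>) * (\<Sum>d<t'. l d x)"
    using c loss unfolding split by (simp add: comparator_def distrib_left)
  finally have 1: "(\<Sum>d<t'. l d (c' d)) \<le> (1 + \<epsilon>) * (\<Sum>d<t'. l d x)" .
  have 3: "bad x j w u \<or>
        (\<exists>i v. j \<le> i \<and> v \<le> u \<and> u < v + Ts i \<and> v + Ts i \<le> t' \<and> tracked w c' i v)"
    if ju: "j < k" "u < t'" "Ts j dvd u" for j u
  proof (cases "u < t")
    case True
    then consider "bad x j w u" | i v where "j \<le> i" "v \<le> u" "u < v + Ts i" "v + Ts i \<le> t"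
        "tracked w c i v"
      using c ju unfolding comparator_def by blast
    then show ?thesis
    proof cases
      case 2
      then have "tracked w c' i v" by (auto simp: tracked_def c'_def)
      then show ?thesis using 2 t' by (intro disjI2 exI[of _ i] exI[of _ v]) auto
    qed simp
  next
    case False
    then consider "bad x j w u" | i v where "i < k" "j \<le> i" "Ts i dvd v" "t \<le> v" "v \<le> u"
        "u < v + Ts i" "v + Ts i \<le> t'" "y \<in> fst ` keys w v i"
      using new[of j u] ju not_less by blast
    then show ?thesis
    proof cases
      case 2
      then have "tracked w c' i v" unfolding tracked_def by (intro conjI bexI[of _ y]) (auto simp: c'_def)
      then show ?thesis using 2 by (intro disjI2 exI[of _ i] exI[of _ v]) auto
    qed simp
  qed
  have 2: "\<forall>d<t'. c' d < n" using c y by (simp add: c'_def comparator_def)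
  show "comparator x w t' c'" unfolding comparator_def using 1 2 3 by blast
qed

lemma comparator_step:
  assumes w: "samples_ok w T" and x: "x < n" and c: "comparator x w t c"
    and t: "t < T" "Ts 0 dvd t"
  shows "\<exists>t'>t. t' \<le> T \<and> Ts 0 dvd t' \<and> (\<exists>c'. comparator x w t' c')"
proof (cases "\<exists>i<k. Ts i dvd t \<and> \<not> bad x i w t")
  case False
  \<comment> \<open>All updated levels are bad: advance by one interval of level 0 with
    \<open>x\<close> itself. No other update falls into it, so nothing has to be covered.\<close>
  have le: "t + Ts 0 \<le> T" using interval_within_T[of 0 t] t by simp
  have pos: "0 < Ts 0" using Ts_pos by simp
  have "0 \<le> \<epsilon>" using t T_eq by (simp add: \<epsilon>_def)
  moreover have "0 \<le> (\<Sum>d\<in>{t..<t + Ts 0}. l d x)"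
    using loss_bounds x le by (intro sum_nonneg) auto
  ultimately have loss: "(\<Sum>d\<in>{t..<t + Ts 0}. l d x) \<le> (1 + \<epsilon>) * (\<Sum>d\<in>{t..<t + Ts 0}. l d x)"
    by (simp add: distrib_right)
  have "\<exists>c'. comparator x w (t + Ts 0) c'"
  proof (rule comparator_extend[OF c _ le x loss])
    fix j u assume u: "j < k" "t \<le> u" "u < t + Ts 0" "Ts j dvd u"
    have "u = t"
    proof (rule ccontr)
      assume "u \<noteq> t"
      then show False using dvd_add_le[OF t(2) Ts0_dvd[OF u(1,4)]] u by simp
    qed
    then show "bad x j w u \<or>
        (\<exists>i v. i < k \<and> j \<le> i \<and> Ts i dvd v \<and> t \<le> v \<and> v \<le> u \<and> u < v + Ts i \<and> v + Ts i \<le> t + Ts 0 \<and>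
               x \<in> fst ` keys w v i)" using False u(1,4) by simp
  qed (use pos in simp)
  then show ?thesis using le pos t(2) by (intro exI[of _ "t + Ts 0"]) auto
next
  case True
  \<comment> \<open>The highest level for which \<open>t\<close> is not bad, so that at
    \<open>t\<close> the levels above it require no cover.\<close>
  define i where "i = Max {i. i < k \<and> Ts i dvd t \<and> \<not> bad x i w t}"
  have "i \<in> {i. i < k \<and> Ts i dvd t \<and> \<not> bad x i w t}"
    unfolding i_def using True by (intro Max_in) auto
  then have i: "i < k" "Ts i dvd t" "\<not> bad x i w t" by auto
  have i_max: "bad x j w t" if "i < j" "j < k" "Ts j dvd t" for j
  proof (rule ccontr)
    assume "\<not> bad x j w t"
    then have "j \<le> i" unfolding i_def using that by (intro Max_ge) auto
    then show False using that by simp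
  qed
  obtain t' and a :: real and y where jump: "t < t'" "t' \<le> T" "Ts i dvd t'" "t' = T \<or> \<tau> t' \<le> t" "a < real t + 1"
    "\<And>v. t \<le> v \<Longrightarrow> v < t' \<Longrightarrow> (y, a) \<in> keys w v i"
    "(\<Sum>d\<in>{t..<t'}. l d y) \<le> (1 + \<epsilon>) * (\<Sum>d\<in>{t..<t'}. l d x)"
    by (rule not_bad_jump[OF w t(1) i(1,2) x i(3)]) (rule that)
  have "(y, a) \<in> keys w t i" using jump by simp
  then have y: "y < n" using mid_entries_ok[OF w t(1) i(1)] by (auto simp: keys_def key_def entry_ok_def)
  have pos: "0 < Ts i" using Ts_pos i by simp
  have t0: "Ts 0 dvd t'" using Ts0_dvd i(1) jump(3) by blast
  have "\<exists>c'. comparator x w t' c'"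
  proof (rule comparator_extend[OF c jump(1,2) y jump(7)])
    fix j u assume u: "j < k" "t \<le> u" "u < t'" "Ts j dvd u"
    \<comment> \<open>Higher levels at \<open>t\<close> itself are bad by the choice of
      \<open>i\<close>; levels up to \<open>i\<close> are covered by intervals of level
      \<open>i\<close>; intervals of higher levels that start after \<open>t\<close> are covered at
      their own level, by forwarding.\<close>
    consider "u = t" "i < j" | "j \<le> i" | "t < u" "i < j" using u by linarith
    then show "bad x j w u \<or>
        (\<exists>i v. i < k \<and> j \<le> i \<and> Ts i dvd v \<and> t \<le> v \<and> v \<le> u \<and> u < v + Ts i \<and> v + Ts i \<le> t' \<and>
               y \<in> fst ` keys w v i)"
    proof cases
      case 1
      then show ?thesis using i_max[of j] u by simp
    next
      case 2
      define v where "v = Ts i * (u div Ts i)"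
      have v: "v \<le> u" "u < v + Ts i" "Ts i dvd v"
        using dividend_less_times_div[OF pos, of u] by (simp_all add: v_def add.commute)
      have "t \<le> v"
        using dvd_add_le[OF v(3) i(2)] v(2) u(2) by linarith
      moreover have "v + Ts i \<le> t'" using dvd_add_le[OF v(3) jump(3)] v(1) u(3) by linarith
      moreover have "(y, a) \<in> keys w v i" using jump(6)[OF \<open>t \<le> v\<close>] v(1) u(3) by simp
      then have "y \<in> fst ` keys w v i" by (rule image_eqI[rotated]) simp
      ultimately show ?thesis using v i(1) 2 by (intro disjI2 exI[of _ i] exI[of _ v]) simp
    next
      case 3
      \<comment> \<open>The eviction at \<open>t'\<close> is limited to the entries of the current epoch, so \<open>t'\<close> lies in a
        later interval of level \<open>j\<close> only if it starts one.\<close>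
      have "Ts j dvd t'"
      proof (cases "t' = T")
        case True
        then show ?thesis using Ts_dvd_T u by simp
      next
        case False
        define S where "S = Ts (Suc (update_level k Ts t'))"
        show ?thesis
        proof (rule ccontr)
          assume "\<not> Ts j dvd t'"
          then have "Suc (update_level k Ts t') \<le> j"
            using le_update_level_iff[OF t0 u(1)] by simp
          then have "S dvd Ts j" unfolding S_def using u(1) by (intro Ts_dvd) auto
          then have "S dvd u" using u(4) dvd_trans by blast
          then have "u = S * (u div S)" by simp
          also have "\<dots> \<le> S * (t' div S)" using u by (intro mult_left_mono div_le_mono) auto
          also have "\<dots> = \<tau> t'" by (simp add: epoch_start_def S_def Let_def)
          finally show False using jump(4) False 3 by simp
        qed
      qed
      then have "u + Ts j \<le> t'" using dvd_add_le u by blast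
      moreover have "(y, a) \<in> keys w u i" using jump(6) u by simp
      \<comment> \<open>\<open>u\<close> is at least \<open>t + 1\<close>, so the entry was in its
        bucket before the update at \<open>u\<close> and is forwarded there.\<close>
      moreover have "a < real u" using jump(5) 3 by linarith
      ultimately have "y \<in> fst ` keys w u j"
        using key_forwarded[of i j u "(y, a)" w] 3 u w jump(2) by simp
      moreover have "u < u + Ts j" using Ts_pos u by simp
      ultimately show ?thesis
        using u \<open>u + Ts j \<le> t'\<close> by (intro disjI2 exI[of _ j] exI[of _ u]) simp
    qed
  qed
  then show ?thesis using jump(1,2) t0 by (intro exI[of _ t']) simp
qed

lemma comparator_exists:
  assumes w: "samples_ok w T" and x: "x < n"
  shows "\<exists>c. comparator x w T c"
proof -
  have "\<exists>c. comparator x w T c" if "comparator x w t c" "t \<le> T" "Ts 0 dvd t" for t c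
    using that
  proof (induction "T - t" arbitrary: t c rule: less_induct)
    case less
    show ?case
    proof (cases "t = T")
      case True
      then show ?thesis using less by blast
    next
      case False
      then obtain t' c' where "t < t'" "t' \<le> T" "Ts 0 dvd t'" "comparator x w t' c'"
        using comparator_step[OF w x less.prems(1) _ less.prems(3)] less.prems(2) by auto
      then show ?thesis using less.hyps[of t' c'] False less.prems(2) by simp
    qed
  qed
  moreover have "comparator x w 0 (\<lambda>_. x)" by (simp add: comparator_def)
  ultimately show ?thesis by auto
qed

section \<open>Open intervals and what they pay\<close>

definition open_at :: "(nat \<Rightarrow> day_randomness) \<Rightarrow> (nat \<Rightarrow> nat) \<Rightarrow> nat \<Rightarrow> nat \<Rightarrow> bool" where
  "open_at w c i u \<longleftrightarrow> \<not> (\<exists>i' v. i \<le> i' \<and> v \<le> u \<and> u < v + Ts i' \<and> tracked w c i' v)"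

definition open_day :: "(nat \<Rightarrow> day_randomness) \<Rightarrow> (nat \<Rightarrow> nat) \<Rightarrow> nat \<Rightarrow> nat \<Rightarrow> real" where
  "open_day w c i d = of_bool (open_at w c i (Ts i * (d div Ts i)))"

text \<open>
  Each level is charged for its regret only on the days whose interval of the next higher level
  is open, at a uniform rate; open intervals of level \<open>0\<close> cost \<open>1\<close> per day.
\<close>

definition charge :: "(nat \<Rightarrow> day_randomness) \<Rightarrow> (nat \<Rightarrow> nat) \<Rightarrow> (nat \<Rightarrow> real) \<Rightarrow> nat \<Rightarrow> nat \<Rightarrow> real" where
  "charge w c R j d = (\<Sum>i<Suc j. 2 * R i / real (Ts i) * open_day w c (Suc i) d) + open_day w c 0 d"

lemma interval_start:
  assumes "i \<le> k" "Ts i dvd u" "u \<le> d" "d < u + Ts i"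
  shows "Ts i * (d div Ts i) = u"
proof -
  obtain q where q: "u = Ts i * q" using assms(2) by (auto elim: dvdE)
  have "d div Ts i = q"
    using assms q by (intro div_nat_eqI) (auto simp: algebra_simps)
  then show ?thesis using q by simp
qed

text \<open>No tracked interval has level \<open>k\<close>, so level \<open>k - 1\<close> pays every
  day. This is the origin of the term \<open>T / sqrt (Ts (k - 1))\<close>.\<close>

lemma open_day_k: "d < T \<Longrightarrow> open_day w c k d = 1"
  by (auto simp: open_day_def open_at_def tracked_def)

lemma top_charge:
  assumes j: "j < k" and u: "Ts j dvd u" "u < T"
    and op: "open_at w c (Suc j) (Ts (Suc j) * (u div Ts (Suc j)))"
  shows "(\<Sum>d\<in>{u..<u + Ts j}. 2 * R j / real (Ts j) * open_day w c (Suc j) d) = 2 * R j"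
proof -
  have pos: "0 < Ts j" using Ts_pos j by simp
  obtain q where q: "Ts (Suc j) = Ts j * q" using Ts_dvd_Suc[OF j] by (auto elim: dvdE)
  have "open_day w c (Suc j) d = 1" if "d \<in> {u..<u + Ts j}" for d
  proof -
    have "Ts j * (d div Ts j) = Ts j * (u div Ts j)"
      using interval_start[of j u d] that j u by simp
    then have "d div Ts j = u div Ts j" using pos by simp
    then have "d div Ts (Suc j) = u div Ts (Suc j)" by (simp add: q div_mult2_eq)
    then show ?thesis using op by (simp add: open_day_def)
  qed
  then show ?thesis using pos by simp
qed

text \<open>Intervals are nested: one of a higher level that contains \<open>u\<close> also contains
  the start of the parent interval of \<open>u\<close>, which is open.\<close>

lemma open_at_self:
  assumes j: "j < k" and u: "Ts j dvd u" "u < T"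
    and op: "open_at w c (Suc j) (Ts (Suc j) * (u div Ts (Suc j)))" and tr: "\<not> tracked w c j u"
  shows "open_at w c j u"
  unfolding open_at_def
proof safe
  fix i' v assume v: "j \<le> i'" "v \<le> u" "u < v + Ts i'" "tracked w c i' v"
  have i': "i' < k" "Ts i' dvd v" using v(4) by (auto simp: tracked_def)
  show False
  proof (cases "i' = j")
    case True
    then have "v = u" using dvd_add_le[of "Ts j" v u] i' u v by fastforce
    then show False using v(4) tr True by simp
  next
    case False
    define S where "S = Ts (Suc j)"
    have "S dvd Ts i'" unfolding S_def using False v(1) i'(1) by (intro Ts_dvd) auto
    then have "S dvd v" using i'(2) dvd_trans by blast
    then have "v = S * (v div S)" by simp
    also have "\<dots> \<le> S * (u div S)" using v by (intro mult_left_mono div_le_mono) auto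
    finally have "v \<le> S * (u div S)" .
    moreover have "S * (u div S) < v + Ts i'"
      using v(3) times_div_less_eq_dividend[of S u] by linarith
    moreover have "Suc j \<le> i'" using False v(1) by simp
    ultimately show False using op v(4) unfolding open_at_def S_def by blast
  qed
qed

text \<open>Descent through the levels. A tracked interval pays \<open>2 * R j\<close> against its
  tracked expert. An untracked one pays \<open>R j\<close> to pass to level \<open>j - 1\<close> and
  is then open itself, so the induction hypothesis applies to its subintervals. At the bottom an
  untracked day costs at most 1.\<close>

lemma loss_le_charge:
  assumes R: "\<And>i. 0 \<le> R i"
    and tracking: "\<And>i u y. i < k \<Longrightarrow> Ts i dvd u \<Longrightarrow> u < T \<Longrightarrow> y \<in> fst ` keys w u i \<Longrightarrow>
       (\<Sum>d\<in>{u..<u + Ts i}. l d (chosen w d i)) \<le> (\<Sum>d\<in>{u..<u + Ts i}. l d y) + 2 * R i"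
    and below: "\<And>i u. i < k \<Longrightarrow> 0 < i \<Longrightarrow> Ts i dvd u \<Longrightarrow> u < T \<Longrightarrow>
       (\<Sum>d\<in>{u..<u + Ts i}. l d (chosen w d i))
         \<le> (\<Sum>d\<in>{u..<u + Ts i}. l d (chosen w d (i - 1))) + R i"
    and chosen: "\<And>d i. d < T \<Longrightarrow> i < k \<Longrightarrow> chosen w d i < n" and c: "\<And>d. d < T \<Longrightarrow> c d < n"
    and j: "j < k" and u: "Ts j dvd u" "u < T"
    and op: "open_at w c (Suc j) (Ts (Suc j) * (u div Ts (Suc j)))"
  shows "(\<Sum>d\<in>{u..<u + Ts j}. l d (chosen w d j)) \<le> (\<Sum>d\<in>{u..<u + Ts j}. l d (c d) + charge w c R j d)"
proof -
  have tracked_case: "(\<Sum>d\<in>{u..<u + Ts j}. l d (chosen w d j))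
      \<le> (\<Sum>d\<in>{u..<u + Ts j}. l d (c d) + charge w c R j d)"
    if j: "j < k" and u: "Ts j dvd u" "u < T"
      and op: "open_at w c (Suc j) (Ts (Suc j) * (u div Ts (Suc j)))" and tr: "tracked w c j u" for j u
  proof -
    obtain y where y: "y \<in> fst ` keys w u j" "\<forall>d\<in>{u..<u + Ts j}. c d = y"
      using tr by (auto simp: tracked_def)
    have "(\<Sum>d\<in>{u..<u + Ts j}. l d (chosen w d j)) \<le> (\<Sum>d\<in>{u..<u + Ts j}. l d y) + 2 * R j"
      using tracking[OF j u y(1)] .
    moreover have "(\<Sum>d\<in>{u..<u + Ts j}. l d y) = (\<Sum>d\<in>{u..<u + Ts j}. l d (c d))"
      using y by (intro sum.cong) auto
    moreover have "(\<Sum>d\<in>{u..<u + Ts j}. 2 * R j / real (Ts j) * open_day w c (Suc j) d)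
        \<le> (\<Sum>d\<in>{u..<u + Ts j}. charge w c R j d)"
    proof (rule sum_mono)
      fix d
      have "0 \<le> (\<Sum>i<j. 2 * R i / real (Ts i) * open_day w c (Suc i) d)"
        using R by (intro sum_nonneg) (auto simp: open_day_def)
      moreover have "0 \<le> open_day w c 0 d" by (simp add: open_day_def)
      ultimately show "2 * R j / real (Ts j) * open_day w c (Suc j) d \<le> charge w c R j d"
        by (simp add: charge_def)
    qed
    ultimately show ?thesis
      using top_charge[OF j u op, of R] unfolding sum.distrib by linarith
  qed
  show ?thesis
    using j u op
  proof (induction j arbitrary: u)
    case 0
    show ?case
    proof (cases "tracked w c 0 u")
      case False
      have le: "u + Ts 0 \<le> T" using interval_within_T[of 0 u] 0 by simp
      have op0: "open_at w c 0 u" using open_at_self[OF 0(1-4) False] .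
      have "(\<Sum>d\<in>{u..<u + Ts 0}. l d (chosen w d 0)) \<le> (\<Sum>d\<in>{u..<u + Ts 0}. l d (c d) + charge w c R 0 d)"
      proof (rule sum_mono)
        fix d assume d: "d \<in> {u..<u + Ts 0}"
        have "open_day w c 0 d = 1"
          using interval_start[of 0 u d] 0 d op0 by (simp add: open_day_def)
        moreover have "0 \<le> 2 * R 0 / real (Ts 0) * open_day w c (Suc 0) d"
          using R by (simp add: open_day_def)
        ultimately have "1 \<le> charge w c R 0 d" by (simp add: charge_def)
        moreover have "d < T" using d le by simp
        ultimately show "l d (chosen w d 0) \<le> l d (c d) + charge w c R 0 d"
          using loss_bounds[OF \<open>d < T\<close> chosen[OF \<open>d < T\<close>, of 0]]
            loss_bounds[OF \<open>d < T\<close> c[OF \<open>d < T\<close>]] k_pos by linarith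
      qed
      then show ?thesis .
    qed (rule tracked_case[OF 0])
  next
    case (Suc j)
    show ?case
    proof (cases "tracked w c (Suc j) u")
      case False
      have j: "j < k" using Suc.prems by simp
      have ops: "open_at w c (Suc j) u" using open_at_self[OF Suc.prems False] .
      obtain q where q: "Ts (Suc j) = q * Ts j"
        using Ts_dvd_Suc[OF j] by (metis dvd_def mult.commute)
      have le: "u + Ts (Suc j) \<le> T" using interval_within_T[of "Suc j" u] Suc.prems by simp
      have "(\<Sum>d\<in>{u..<u + Ts (Suc j)}. l d (chosen w d (Suc j)))
          \<le> (\<Sum>d\<in>{u..<u + Ts (Suc j)}. l d (chosen w d j)) + R (Suc j)"
        using below[OF Suc.prems(1) _ Suc.prems(2,3)] by simp
      moreover have "(\<Sum>d\<in>{u..<u + Ts (Suc j)}. l d (chosen w d j))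
          \<le> (\<Sum>d\<in>{u..<u + Ts (Suc j)}. l d (c d) + charge w c R j d)"
        unfolding q
      proof (rule sum_le_of_blocks)
        fix b assume b: "b < q"
        define u' where "u' = u + b * Ts j"
        have "Suc b * Ts j \<le> q * Ts j" using b by (intro mult_right_mono) auto
        then have u': "u \<le> u'" "u' + Ts j \<le> u + Ts (Suc j)" by (simp_all add: u'_def q)
        have pos: "0 < Ts j" using Ts_pos j by simp
        have "Ts j dvd u" using Ts_dvd_Suc[OF j] Suc.prems(2) by (rule dvd_trans)
        then have "Ts j dvd u'" by (simp add: u'_def)
        moreover have "u' < T" using u' pos le by linarith
        moreover have "Ts (Suc j) * (u' div Ts (Suc j)) = u"
          using interval_start[of "Suc j" u u'] u' pos Suc.prems by simp
        then have "open_at w c (Suc j) (Ts (Suc j) * (u' div Ts (Suc j)))" using ops by simp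
        ultimately show "(\<Sum>d\<in>{u + b * Ts j..<u + b * Ts j + Ts j}. l d (chosen w d j))
            \<le> (\<Sum>d\<in>{u + b * Ts j..<u + b * Ts j + Ts j}. l d (c d) + charge w c R j d)"
          using Suc.IH[OF j] unfolding u'_def by blast
      qed
      moreover have "R (Suc j) \<le>
          (\<Sum>d\<in>{u..<u + Ts (Suc j)}. 2 * R (Suc j) / real (Ts (Suc j)) * open_day w c (Suc (Suc j)) d)"
        unfolding top_charge[OF Suc.prems] using R[of "Suc j"] by simp
      moreover have "(\<Sum>d\<in>{u..<u + Ts (Suc j)}. l d (c d) + charge w c R j d)
          + (\<Sum>d\<in>{u..<u + Ts (Suc j)}. 2 * R (Suc j) / real (Ts (Suc j)) * open_day w c (Suc (Suc j)) d)
          = (\<Sum>d\<in>{u..<u + Ts (Suc j)}. l d (c d) + charge w c R (Suc j) d)"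
        unfolding sum.distrib[symmetric] by (intro sum.cong refl) (simp add: charge_def)
      ultimately show ?thesis by linarith
    qed (rule tracked_case[OF Suc.prems])
  qed
qed

text \<open>The covering property of the comparator leaves an open interval no choice but to start
  at a bad time.\<close>

lemma sum_open_day_le:
  assumes c: "comparator x w T c" and i: "i < k"
  shows "(\<Sum>d<T. open_day w c i d) \<le> real (Ts i) * real (card {u. u < T \<and> Ts i dvd u \<and> bad x i w u})"
proof -
  define A where "A = {u. u < T \<and> Ts i dvd u \<and> bad x i w u}"
  have "(\<Sum>d<T. open_day w c i d) = (\<Sum>d | d < T \<and> open_at w c i (Ts i * (d div Ts i)). 1)"
    by (intro sum.mono_neutral_cong_right) (auto simp: open_day_def)
  also have "\<dots> = real (card {d. d < T \<and> open_at w c i (Ts i * (d div Ts i))})" by simp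
  finally have days: "(\<Sum>d<T. open_day w c i d)
      = real (card {d. d < T \<and> open_at w c i (Ts i * (d div Ts i))})" .
  have "card {d. d < T \<and> open_at w c i (Ts i * (d div Ts i))} \<le> card (\<Union>u\<in>A. {u..<u + Ts i})"
  proof (rule card_mono)
    show "{d. d < T \<and> open_at w c i (Ts i * (d div Ts i))} \<subseteq> (\<Union>u\<in>A. {u..<u + Ts i})"
    proof safe
      fix d assume d: "d < T" "open_at w c i (Ts i * (d div Ts i))"
      define u where "u = Ts i * (d div Ts i)"
      have u: "u \<le> d" "d < u + Ts i" "Ts i dvd u"
        using dividend_less_times_div[OF Ts_pos, of i d] i by (simp_all add: u_def add.commute)
      have "bad x i w u"
      proof (rule ccontr)
        assume nb: "\<not> bad x i w u"
        have "u < T" using u(1) d(1) by simp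
        with c i u(3) have "bad x i w u \<or>
            (\<exists>i' v. i \<le> i' \<and> v \<le> u \<and> u < v + Ts i' \<and> v + Ts i' \<le> T \<and> tracked w c i' v)"
          unfolding comparator_def by simp
        with nb d(2) show False unfolding open_at_def u_def by auto
      qed
      then show "d \<in> (\<Union>u\<in>A. {u..<u + Ts i})" using u d(1) by (intro UN_I[of u]) (auto simp: A_def)
    qed
  qed (simp add: A_def)
  also have "card (\<Union>u\<in>A. {u..<u + Ts i}) \<le> (\<Sum>u\<in>A. card {u..<u + Ts i})"
    by (rule card_UN_le) (simp add: A_def)
  also have "\<dots> = Ts i * card A" by simp
  finally show ?thesis unfolding days A_def of_nat_mult[symmetric] of_nat_le_iff .
qed

lemma regret_le:
  fixes \<rho> N :: real
  assumes w: "w \<in> set_pmf (run_pmf T)" and x: "x < n" and \<rho>: "1 / 2 \<le> \<rho>" and N: "0 \<le> N"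
    and tracking: "\<And>i u y. i < k \<Longrightarrow> Ts i dvd u \<Longrightarrow> u < T \<Longrightarrow> y \<in> fst ` keys w u i \<Longrightarrow>
       (\<Sum>d\<in>{u..<u + Ts i}. l d (chosen w d i))
         \<le> (\<Sum>d\<in>{u..<u + Ts i}. l d y) + 2 * (\<rho> * sqrt (real (Ts i)))"
    and below: "\<And>i u. i < k \<Longrightarrow> 0 < i \<Longrightarrow> Ts i dvd u \<Longrightarrow> u < T \<Longrightarrow>
       (\<Sum>d\<in>{u..<u + Ts i}. l d (chosen w d i))
         \<le> (\<Sum>d\<in>{u..<u + Ts i}. l d (chosen w d (i - 1))) + \<rho> * sqrt (real (Ts i))"
    and bad: "\<And>i. i < k \<Longrightarrow> real (card {u. u < T \<and> Ts i dvd u \<and> bad x i w u}) \<le> N"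
  shows "(\<Sum>d<T. l d (chosen w d (k - 1))) - (\<Sum>d<T. l d x)
     \<le> \<epsilon> * real T + 2 * \<rho> * (real T / sqrt (real (Ts (k - 1)))
                           + N * (\<Sum>i<k. real (Ts i) / sqrt (real (prev_scale Ts i))))"
proof -
  define R where "R = (\<lambda>i. \<rho> * sqrt (real (Ts i)))"
  have T: "0 < T" using Ts_pos[of k] T_eq by simp
  obtain c where c: "comparator x w T c" 
    using comparator_exists[OF samples_ok_run_pmf[OF w] x] by (rule exE)
  define k' where "k' = k - 1"
  have k': "Suc k' = k" "k' < k" using k_pos by (simp_all add: k'_def)
  have sum_last: "(\<Sum>i<k. f i) = (\<Sum>i<k'. f i) + f k'"
    and sum_first: "(\<Sum>i<k. f i) = f 0 + (\<Sum>i<k'. f (Suc i))" for f :: "nat \<Rightarrow> real"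
    unfolding k'(1)[symmetric] by (rule sum.lessThan_Suc, rule sum.lessThan_Suc_shift)
  obtain q where q: "T = q * Ts k'"
    using dvd_div_mult_self[OF Ts_dvd_T[OF less_imp_le[OF k'(2)]]] by (intro that[of "T div Ts k'"]) simp
  define G where "G = (\<lambda>i. \<Sum>d<T. open_day w c i d)"
  have "(\<Sum>d<T. l d (chosen w d k')) \<le> (\<Sum>d<T. l d (c d) + charge w c R k' d)"
  proof -
    have "(\<Sum>d\<in>{0..<0 + q * Ts k'}. l d (chosen w d k'))
        \<le> (\<Sum>d\<in>{0..<0 + q * Ts k'}. l d (c d) + charge w c R k' d)"
    proof (rule sum_le_of_blocks)
      fix b assume "b < q"
      have less: "b * Ts k' < T" using \<open>b < q\<close> Ts_pos[of k'] k' by (simp add: q)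
      have "open_at w c (Suc k') (Ts (Suc k') * (b * Ts k' div Ts (Suc k')))"
        using k' unfolding open_at_def tracked_def by auto
      then show "(\<Sum>d\<in>{0 + b * Ts k'..<0 + b * Ts k' + Ts k'}. l d (chosen w d k'))
        \<le> (\<Sum>d\<in>{0 + b * Ts k'..<0 + b * Ts k' + Ts k'}. l d (c d) + charge w c R k' d)"
      proof (intro loss_le_charge)
        show "0 \<le> R i" for i using \<rho> by (simp add: R_def)
        show "c d < n" if "d < T" for d using c that by (simp add: comparator_def)
        show "chosen w d i < n" if "d < T" "i < k" for d i using chosen_less[OF w that] .
        show "(\<Sum>d\<in>{u..<u + Ts i}. l d (chosen w d i)) \<le> (\<Sum>d\<in>{u..<u + Ts i}. l d y) + 2 * R i"
          if "i < k" "Ts i dvd u" "u < T" "y \<in> fst ` keys w u i" for i u y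
          unfolding R_def using tracking[OF that] .
        show "(\<Sum>d\<in>{u..<u + Ts i}. l d (chosen w d i))
            \<le> (\<Sum>d\<in>{u..<u + Ts i}. l d (chosen w d (i - 1))) + R i"
          if "i < k" "0 < i" "Ts i dvd u" "u < T" for i u
          unfolding R_def using below[OF that] .
      qed (use less k' in auto)
    qed
    then show ?thesis by (simp add: lessThan_atLeast0 flip: q)
  qed
  then have total: "(\<Sum>d<T. l d (chosen w d k'))
      \<le> (\<Sum>d<T. l d (c d)) + (\<Sum>d<T. charge w c R k' d)" by (simp add: sum.distrib)
  have "(\<Sum>d<T. l d (c d)) \<le> (1 + \<epsilon>) * (\<Sum>d<T. l d x)" using c by (simp add: comparator_def)
  also have "\<dots> \<le> (\<Sum>d<T. l d x) + \<epsilon> * real T"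
  proof -
    have "(\<Sum>d<T. l d x) \<le> (\<Sum>d<T. 1)" using loss_bounds x by (intro sum_mono) auto
    moreover have "0 \<le> \<epsilon>" using T T_eq by (simp add: \<epsilon>_def)
    ultimately show ?thesis using mult_left_mono[of "\<Sum>d<T. l d x" "real T" \<epsilon>] by (simp add: distrib_right)
  qed
  finally have comp: "(\<Sum>d<T. l d (c d)) \<le> (\<Sum>d<T. l d x) + \<epsilon> * real T" .
  have "(\<Sum>d<T. charge w c R k' d) = (\<Sum>i<k. 2 * R i / real (Ts i) * G (Suc i)) + G 0"
    unfolding charge_def sum.distrib k' G_def sum_distrib_left by (subst sum.swap) (rule refl)
  also have "\<dots> \<le> 2 * \<rho> * (real T / sqrt (real (Ts (k - 1)))
                           + N * (\<Sum>i<k. real (Ts i) / sqrt (real (prev_scale Ts i))))"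
  proof -
    have G_le: "G i \<le> real (Ts i) * N" if "i < k" for i
      using sum_open_day_le[OF c that] bad[OF that] mult_left_mono[OF bad[OF that], of "real (Ts i)"]
      unfolding G_def by linarith
    have G_k: "G (Suc k') = real T" using k' open_day_k[of _ w c] by (simp add: G_def)
    have rate: "2 * R i / real (Ts i) = 2 * \<rho> / sqrt (real (Ts i))" for i
      by (cases "Ts i = 0") (simp_all add: R_def field_simps)
    have "(\<Sum>i<k. 2 * R i / real (Ts i) * G (Suc i)) + G 0
        = (\<Sum>i<k'. 2 * \<rho> / sqrt (real (Ts i)) * G (Suc i)) + 2 * \<rho> / sqrt (real (Ts k')) * real T + G 0"
      unfolding sum_last rate G_k ..
    also have "\<dots> \<le> (\<Sum>i<k'. 2 * \<rho> / sqrt (real (Ts i)) * (real (Ts (Suc i)) * N))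
        + 2 * \<rho> / sqrt (real (Ts k')) * real T + (2 * \<rho>) * (real (Ts 0) * N)"
    proof (intro add_mono sum_mono mult_left_mono G_le)
      \<comment> \<open>The unit cost of open days of level 0 becomes the summand
        \<open>i = 0\<close>, where \<open>prev_scale\<close> is 1;
        \<open>1 / 2 \<le> \<rho>\<close> absorbs it into the common factor.\<close>
      have "1 * (real (Ts 0) * N) \<le> (2 * \<rho>) * (real (Ts 0) * N)"
        using \<rho> N by (intro mult_right_mono) auto
      then show "G 0 \<le> (2 * \<rho>) * (real (Ts 0) * N)" using G_le[of 0] k_pos by simp
    qed (use \<rho> k' in auto)
    also have "\<dots> = 2 * \<rho> * (real T / sqrt (real (Ts (k - 1)))
                           + N * (\<Sum>i<k. real (Ts i) / sqrt (real (prev_scale Ts i))))"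
      unfolding sum_first
      by (simp add: prev_scale_def ring_distribs sum_distrib_left mult_ac k'_def)
    finally show ?thesis .
  qed
  finally have "(\<Sum>d<T. charge w c R k' d)
      \<le> 2 * \<rho> * (real T / sqrt (real (Ts (k - 1)))
                           + N * (\<Sum>i<k. real (Ts i) / sqrt (real (prev_scale Ts i))))" .
  then show ?thesis using total comp by (simp add: k'_def)
qed

section \<open>Bucket sizes\<close>

text \<open>Only additions are counted: an update of level \<open>i\<close> adds at most the lower
  buckets and \<open>m\<close> samples. The crudeness is harmless, as only the logarithm
  matters.\<close>

lemma length_bucket_mid:
  assumes w: "samples_ok w T"
  shows "t < T \<Longrightarrow> i < k \<Longrightarrow> length (bucket (mid w t) i) \<le> m * (t + 1) ^ Suc i"
proof -
  \<comment> \<open>Telescoping: the bounds for the lower levels and the \<open>m\<close> fresh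
    samples add up to \<open>m * (t + 1) ^ i\<close>.\<close>
  have geo: "(\<Sum>j<i. t * (t + 1) ^ j) + 1 = (t + 1) ^ i" for t i :: nat
    by (induction i) auto
  have mid: "length (bucket (mid w t) i) \<le> m * (t + 1) ^ Suc i"
    if st: "\<And>j. j < k \<Longrightarrow> length (bucket (st w t) j) \<le> m * t * (t + 1) ^ j" and "t < T" "i < k" for t i
  proof (cases "Ts i dvd t")
    case True
    have kept: "length (kept w t j) \<le> m * t * (t + 1) ^ j" if "j < k" for j
      using st[OF that] unfolding kept_def evict_def length_map
      by (rule order_trans[OF length_filter_le])
    have "length (forwarded w t i) = (\<Sum>j<i. length (kept w t j))"
      by (simp add: forwarded_def length_concat o_def interv_sum_list_conv_sum_set_nat lessThan_atLeast0)
    also have "\<dots> \<le> (\<Sum>j<i. m * t * (t + 1) ^ j)" using kept that by (intro sum_mono) auto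
    finally have fw: "length (forwarded w t i) \<le> m * (\<Sum>j<i. t * (t + 1) ^ j)"
      by (simp add: sum_distrib_left mult.assoc)
    have "length (bucket (mid w t) i) = length (kept w t i) + length (forwarded w t i) + m"
      using True that w by (simp add: bucket_mid new_entries_def samples_ok_def)
    also have "\<dots> \<le> m * t * (t + 1) ^ i + m * ((\<Sum>j<i. t * (t + 1) ^ j) + 1)"
      using kept[OF that(3)] fw by simp
    also have "\<dots> = m * (t + 1) ^ Suc i" unfolding geo by (simp add: algebra_simps)
    finally show ?thesis .
  next
    case False
    then have "length (bucket (mid w t) i) \<le> m * t * (t + 1) ^ i" using st that by (simp add: bucket_mid)
    also have "\<dots> \<le> m * (t + 1) ^ Suc i" by (simp add: algebra_simps)
    finally show ?thesis .
  qed
  have st: "length (bucket (st w t) i) \<le> m * t * (t + 1) ^ i" if "t \<le> T" "i < k" for t i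
    using that
  proof (induction t arbitrary: i)
    case 0
    then show ?case by (simp add: init_state_def)
  next
    case (Suc t)
    have "length (bucket (st w (Suc t)) i) = length (bucket (mid w t) i)"
      by (simp add: bucket_st_Suc del: st.simps)
    also have "\<dots> \<le> m * (t + 1) ^ Suc i" using Suc by (intro mid) auto
    also have "\<dots> \<le> m * (Suc t * (Suc t + 1) ^ i)"
      unfolding power_Suc by (intro mult_le_mono power_mono) auto
    finally show ?case unfolding mult.assoc .
  qed
  then show "t < T \<Longrightarrow> i < k \<Longrightarrow> length (bucket (mid w t) i) \<le> m * (t + 1) ^ Suc i"
    using mid st by simp
qed

lemma two_power_le_T: "2 ^ k \<le> T"
proof -
  have "i \<le> k \<Longrightarrow> 2 ^ i \<le> Ts i" for i
  proof (induction i)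
    case 0
    then show ?case using Ts_pos[of 0] by simp
  next
    case (Suc i)
    obtain q where q: "Ts (Suc i) = Ts i * q" using Ts_dvd_Suc[of i] Suc.prems by (auto elim: dvdE)
    have "Ts i < Ts i * q" using Ts_less_Suc[of i] Suc.prems by (simp add: q)
    then have "2 \<le> q" by (cases q) auto
    then have "2 ^ i * 2 \<le> Ts i * q" using Suc by (intro mult_mono) auto
    then show ?case by (simp add: q mult.commute)
  qed
  then show ?thesis by (simp add: T_eq)
qed

lemma T_ge_2: "2 \<le> T"
proof -
  have "(2::nat) ^ 1 \<le> 2 ^ k" using k_pos by (intro power_increasing) auto
  then show ?thesis using two_power_le_T by simp
qed

lemma ln_T_ge: "1 / 2 \<le> ln (real T)"
proof -
  have "ln (2::real) \<le> ln (real T)" using T_ge_2 by (subst ln_le_cancel_iff) auto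
  moreover have "1 / 2 \<le> ln (2::real)" using ln_add_one_self_le_self2[of "- 1/2"] by (simp add: ln_div)
  ultimately show ?thesis by simp
qed

text \<open>The scales at least double, so \<open>k \<le> 2 * ln T\<close>, and the logarithm of
  \<open>m * T ^ k\<close> is of order \<open>(ln T)\<^sup>2\<close>.\<close>

lemma ln_length_bucket:
  assumes w: "samples_ok w T" and t: "t < T" and i: "i < k" and m: "real m \<le> real T powr c" and c: "0 < c"
  shows "ln (real (length (bucket (mid w t) i))) \<le> (2 * c + 2) * (ln (real T))\<^sup>2"
proof -
  define L where "L = ln (real T)"
  have L: "1 / 2 \<le> L" using ln_T_ge by (simp add: L_def)
  have "length (bucket (mid w t) i) \<noteq> 0" using bucket_mid_nonempty[OF w t i] by simp
  moreover have "length (bucket (mid w t) i) \<le> m * T ^ k"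
  proof -
    have "(t + 1) ^ Suc i \<le> T ^ Suc i" using t by (intro power_mono) auto
    also have "\<dots> \<le> T ^ k" using i T_ge_2 by (intro power_increasing) auto
    finally show ?thesis using length_bucket_mid[OF w t i] by (meson mult_le_mono2 order_trans)
  qed
  then have "real (length (bucket (mid w t) i)) \<le> real m * real T ^ k"
    by (metis of_nat_le_iff of_nat_mult of_nat_power)
  ultimately have "ln (real (length (bucket (mid w t) i))) \<le> ln (real m * real T ^ k)"
    by (subst ln_le_cancel_iff) (use m_pos T_ge_2 in auto)
  also have "\<dots> = ln (real m) + real k * L"
    using m_pos T_ge_2 by (simp add: ln_mult ln_realpow L_def)
  also have "ln (real m) \<le> c * L"
  proof -
    have "ln (real m) \<le> ln (real T powr c)" using m m_pos T_ge_2 by (subst ln_le_cancel_iff) auto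
    then show ?thesis using T_ge_2 by (simp add: L_def ln_powr)
  qed
  also have "c * L \<le> c * (2 * L\<^sup>2)"
    using L c by (intro mult_left_mono) (auto simp: power2_eq_square)
  also have "real k * L \<le> (2 * L) * L"
  proof (rule mult_right_mono)
    have "(2::real) ^ k \<le> real T" using two_power_le_T by (metis of_nat_le_iff of_nat_numeral of_nat_power)
    then have "ln ((2::real) ^ k) \<le> ln (real T)" using T_ge_2 by (subst ln_le_cancel_iff) auto
    then have "real k * ln 2 \<le> L" by (simp add: ln_realpow L_def)
    moreover have "1 / 2 \<le> ln (2::real)" using ln_add_one_self_le_self2[of "- 1/2"] by (simp add: ln_div)
    then have "real k * (1 / 2) \<le> real k * ln 2" by (intro mult_left_mono) auto
    ultimately show "real k \<le> 2 * L" by simp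
  qed (use L in simp)
  finally show ?thesis by (simp add: L_def power2_eq_square algebra_simps)
qed

subsection \<open>The regret bound\<close>

definition draws_deviate :: "real \<Rightarrow> nat \<Rightarrow> nat \<Rightarrow> (nat \<Rightarrow> day_randomness) set" where
  "draws_deviate b i u = {w. (b + 1) * sqrt (real (Ts i)) \<le>
     (\<Sum>j<Ts i. l (u + j) (drawn w (u + j) i) - mean_loss (l (u + j)) (bucket (mid w (u + j)) i))}"

definition coins_deviate :: "real \<Rightarrow> nat \<Rightarrow> nat \<Rightarrow> (nat \<Rightarrow> day_randomness) set" where
  "coins_deviate b i u = {w. (b + 1) * sqrt (real (Ts i)) \<le>
     (\<Sum>j<Ts i. l (u + j) (chosen w (u + j) i) - mean_choice_loss w (u + j) i)}"

definition many_misses :: "real \<Rightarrow> nat \<Rightarrow> nat \<Rightarrow> nat \<Rightarrow> (nat \<Rightarrow> day_randomness) set" where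
  "many_misses b x i d = {w. exp b \<le> (\<Prod>t<T. miss_factor x i d t w)}"

text \<open>One index \<open>u\<close> serves as the start of an interval and as the cut-off day of
  the misses; the guards concern the first role only.\<close>

definition exceptional :: "real \<Rightarrow> nat \<Rightarrow> nat \<Rightarrow> nat \<Rightarrow> (nat \<Rightarrow> day_randomness) set" where
  "exceptional b x i u =
     (if Ts i dvd u \<and> u < T then draws_deviate b i u else {}) \<union>
     (if Ts i dvd u \<and> u < T \<and> 0 < i then coins_deviate b i u else {}) \<union>
     many_misses b x i u"

lemma prob_exceptional:
  assumes i: "i < k" and x: "x < n"
  shows "measure_pmf.prob (run_pmf T) (exceptional b x i u) \<le> 3 * exp (- b)"
proof -
  have *: "measure_pmf.prob (run_pmf T) (if Q then A else {}) \<le> exp (- b)"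
    if "Q \<Longrightarrow> measure_pmf.prob (run_pmf T) A \<le> exp (- b)" for Q A
    using that by auto
  define D where "D = (if Ts i dvd u \<and> u < T then draws_deviate b i u else {})"
  define C where "C = (if Ts i dvd u \<and> u < T \<and> 0 < i then coins_deviate b i u else {})"
  have "measure_pmf.prob (run_pmf T) D \<le> exp (- b)"
    unfolding D_def draws_deviate_def by (rule *) (use prob_draws_deviation[OF i] in blast)
  moreover have "measure_pmf.prob (run_pmf T) C \<le> exp (- b)"
    unfolding C_def coins_deviate_def by (rule *) (use prob_coins_deviation[OF i] in blast)
  moreover have "measure_pmf.prob (run_pmf T) (many_misses b x i u) \<le> exp (- b)"
    unfolding many_misses_def by (rule prob_misses[OF x i])
  moreover have "measure_pmf.prob (run_pmf T) (D \<union> C \<union> many_misses b x i u)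
      \<le> measure_pmf.prob (run_pmf T) D + measure_pmf.prob (run_pmf T) C
          + measure_pmf.prob (run_pmf T) (many_misses b x i u)"
    using measure_Un_le[of "D \<union> C" "measure_pmf (run_pmf T)" "many_misses b x i u"]
      measure_Un_le[of D "measure_pmf (run_pmf T)" C] by simp
  ultimately show ?thesis unfolding exceptional_def D_def C_def by linarith
qed

lemma regret_le_unless_exceptional:
  fixes \<gamma> c :: real
  assumes w: "w \<in> set_pmf (run_pmf T)" and x: "x < n"
    and m: "real m \<le> real T powr c" and c: "0 < c" and \<gamma>: "0 < \<gamma>"
  defines "b \<equiv> (\<gamma> + 2) * ln (real T)"
  defines "\<rho> \<equiv> (2 * sqrt (2 * c + 2) + \<gamma> + 10) * ln (real T)"
  assumes good: "\<And>i u. i < k \<Longrightarrow> u \<le> T \<Longrightarrow> w \<notin> exceptional b x i u"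
  shows "(\<Sum>d<T. l d (chosen w d (k - 1))) - (\<Sum>d<T. l d x)
     \<le> \<epsilon> * real T + 2 * \<rho> * (real T / sqrt (real (Ts (k - 1)))
          + real n * b / real m * (\<Sum>i<k. real (Ts i) / sqrt (real (prev_scale Ts i))))"
proof -
  define L where "L = ln (real T)"
  have L: "1 / 2 \<le> L" using ln_T_ge by (simp add: L_def)
  have ok: "samples_ok w T" using samples_ok_run_pmf w .
  have b: "0 \<le> b" using \<gamma> L by (simp add: b_def flip: L_def)
  have b1: "b + 1 \<le> (\<gamma> + 4) * L" using L by (simp add: b_def algebra_simps flip: L_def)
  have s0: "0 \<le> sqrt (2 * c + 2)" using c by simp
  \<comment> \<open>Origin of \<rho>: the square root stems from the bucket size, and
    \<open>1 / 2 \<le> L\<close> gives \<open>b + 1 \<le> (\<gamma> + 4) * L\<close> as well as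
    \<open>3 \<le> 6 * L\<close> for the coins.\<close>
  have draw_rate: "2 * (sqrt (2 * c + 2) * L) + (b + 1) \<le> \<rho>"
    using b1 L by (simp add: \<rho>_def algebra_simps flip: L_def)
  have coin_rate: "3 + (b + 1) \<le> \<rho>"
  proof -
    have "0 \<le> sqrt (2 * c + 2) * L" using s0 L by simp
    then show ?thesis using b1 L by (simp add: \<rho>_def algebra_simps flip: L_def)
  qed
  have draws: "(\<Sum>d\<in>{u..<u + Ts i}. l d (drawn w d i))
      \<le> (\<Sum>d\<in>{u..<u + Ts i}. l d y) + \<rho> * sqrt (real (Ts i))"
    if i: "i < k" and u: "Ts i dvd u" "u < T" and y: "y \<in> fst ` keys w u i" for i u y
  proof -
    have len: "0 < length (bucket (mid w u) i)" using bucket_mid_nonempty[OF ok u(2) i] by simp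
    have "w \<notin> draws_deviate b i u" using good[OF i, of u] u by (simp add: exceptional_def)
    then have "(\<Sum>j<Ts i. l (u + j) (drawn w (u + j) i))
        - (\<Sum>j<Ts i. mean_loss (l (u + j)) (bucket (mid w (u + j)) i)) \<le> (b + 1) * sqrt (real (Ts i))"
      by (simp add: draws_deviate_def sum_subtractf)
    moreover have "y \<in> expert ` set (bucket (mid w u) i)"
      using y by (auto simp: keys_def key_def)
    then have "(\<Sum>j<Ts i. mean_loss (l (u + j)) (bucket (mid w (u + j)) i))
        \<le> (\<Sum>j<Ts i. l (u + j) y)
          + 2 * sqrt (real (Ts i) * ln (real (length (bucket (mid w u) i))))"
      by (rule mean_loss_regret[OF ok i u])
    moreover have "sqrt (real (Ts i) * ln (real (length (bucket (mid w u) i))))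
        \<le> sqrt (real (Ts i) * ((2 * c + 2) * L\<^sup>2))"
      using ln_length_bucket[OF ok u(2) i m c]
      by (intro real_sqrt_le_mono mult_left_mono) (auto simp: L_def)
    moreover have "sqrt (real (Ts i) * ((2 * c + 2) * L\<^sup>2))
        = sqrt (2 * c + 2) * L * sqrt (real (Ts i))"
      using L by (simp add: real_sqrt_mult)
    moreover have "(2 * (sqrt (2 * c + 2) * L) + (b + 1)) * sqrt (real (Ts i)) \<le> \<rho> * sqrt (real (Ts i))"
      using draw_rate by (intro mult_right_mono) auto
    then have "2 * (sqrt (2 * c + 2) * L * sqrt (real (Ts i))) + (b + 1) * sqrt (real (Ts i))
        \<le> \<rho> * sqrt (real (Ts i))"
      by (simp only: distrib_right mult.assoc)
    ultimately show ?thesis unfolding sum_lessThan_shift[symmetric] by linarith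
  qed
  have coins: "(\<Sum>d\<in>{u..<u + Ts i}. l d (chosen w d i))
        \<le> (\<Sum>d\<in>{u..<u + Ts i}. l d (drawn w d i)) + \<rho> * sqrt (real (Ts i))"
      "(\<Sum>d\<in>{u..<u + Ts i}. l d (chosen w d i))
        \<le> (\<Sum>d\<in>{u..<u + Ts i}. l d (chosen w d (i - 1))) + \<rho> * sqrt (real (Ts i))"
    if i: "i < k" "0 < i" and u: "Ts i dvd u" "u < T" for i u
  proof -
    have "w \<notin> coins_deviate b i u" using good[OF i(1), of u] u i by (simp add: exceptional_def)
    then have "(\<Sum>j<Ts i. l (u + j) (chosen w (u + j) i))
        - (\<Sum>j<Ts i. mean_choice_loss w (u + j) i) \<le> (b + 1) * sqrt (real (Ts i))"
      by (simp add: coins_deviate_def sum_subtractf)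
    moreover have "(3 + (b + 1)) * sqrt (real (Ts i)) \<le> \<rho> * sqrt (real (Ts i))"
      using coin_rate by (intro mult_right_mono) auto
    then have "3 * sqrt (real (Ts i)) + (b + 1) * sqrt (real (Ts i)) \<le> \<rho> * sqrt (real (Ts i))"
      by (simp only: distrib_right)
    ultimately show "(\<Sum>d\<in>{u..<u + Ts i}. l d (chosen w d i))
        \<le> (\<Sum>d\<in>{u..<u + Ts i}. l d (drawn w d i)) + \<rho> * sqrt (real (Ts i))"
      "(\<Sum>d\<in>{u..<u + Ts i}. l d (chosen w d i))
        \<le> (\<Sum>d\<in>{u..<u + Ts i}. l d (chosen w d (i - 1))) + \<rho> * sqrt (real (Ts i))"
      using mean_choice_loss_regret[OF w i u] unfolding sum_lessThan_shift[symmetric]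
      by linarith+
  qed
  have \<rho>: "1 / 2 \<le> \<rho>"
    using coin_rate b by linarith
  show ?thesis
  proof (rule regret_le[OF w x \<rho>])
    show "0 \<le> real n * b / real m" using b by simp
    show "(\<Sum>d\<in>{u..<u + Ts i}. l d (chosen w d i))
        \<le> (\<Sum>d\<in>{u..<u + Ts i}. l d (chosen w d (i - 1))) + \<rho> * sqrt (real (Ts i))"
      if "i < k" "0 < i" "Ts i dvd u" "u < T" for i u
      using coins(2)[OF that] .
    show "(\<Sum>d\<in>{u..<u + Ts i}. l d (chosen w d i))
        \<le> (\<Sum>d\<in>{u..<u + Ts i}. l d y) + 2 * (\<rho> * sqrt (real (Ts i)))"
      if "i < k" "Ts i dvd u" "u < T" "y \<in> fst ` keys w u i" for i u y
    \<comment> \<open>One \<rho> pays for the draw against \<open>y\<close>, another for the level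
      against its draw. At level 0 the choice is the draw.\<close>
    proof (cases "i = 0")
      case True
      have "0 \<le> \<rho> * sqrt (real (Ts i))" using \<rho> by simp
      then show ?thesis using draws[OF that] by (simp add: True)
    next
      case False
      then show ?thesis using coins(1)[OF that(1) _ that(2,3)] draws[OF that] by simp
    qed
    show "real (card {u. u < T \<and> Ts i dvd u \<and> bad x i w u}) \<le> real n * b / real m" if i: "i < k" for i
    proof -
      have "(\<Prod>t<T. miss_factor x i d t w) < exp b" if "d \<le> T" for d
        using good[OF i that] by (simp add: exceptional_def many_misses_def not_le)
      then have "real m * real (card {u. u < T \<and> Ts i dvd u \<and> bad x i w u}) \<le> real n * b"
        by (rule card_bad_le[OF b])
      then show ?thesis using m_pos by (simp add: field_simps)
    qed
  qed
qed

text \<open>There are \<open>k * (T + 1) \<le> 2 * T\<^sup>2\<close> index pairs, each of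
  probability at most \<open>3 * exp (- b)\<close>; the 2 in \<open>b\<close> pays for their
  number.\<close>

lemma prob_some_exceptional:
  fixes \<gamma> :: real
  assumes x: "x < n"
  defines "b \<equiv> (\<gamma> + 2) * ln (real T)"
  shows "measure_pmf.prob (run_pmf T) (\<Union>(i, u)\<in>{..<k} \<times> {..T}. exceptional b x i u)
           \<le> 6 * real T powr (- \<gamma>)"
proof -
  have T: "0 < real T" using T_ge_2 by simp
  have "measure_pmf.prob (run_pmf T) (\<Union>(i, u)\<in>{..<k} \<times> {..T}. exceptional b x i u)
      \<le> (\<Sum>(i, u)\<in>{..<k} \<times> {..T}. measure_pmf.prob (run_pmf T) (exceptional b x i u))"
    using measure_pmf.finite_measure_subadditive_finite[of "{..<k} \<times> {..T}"
        "\<lambda>(i, u). exceptional b x i u" "run_pmf T"]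
    by (simp add: case_prod_unfold)
  also have "\<dots> \<le> (\<Sum>(i, u)\<in>{..<k} \<times> {..T}. 3 * exp (- b))"
    using prob_exceptional[OF _ x] by (intro sum_mono) auto
  also have "\<dots> = real (k * (T + 1)) * (3 * exp (- b))" by simp
  also have "\<dots> \<le> real (2 * (T * T)) * (3 * exp (- b))"
  proof -
    have "k < 2 ^ k" by (rule less_exp)
    then have "k \<le> T" using two_power_le_T by linarith
    then have "k * (T + 1) \<le> T * (2 * T)" using T_ge_2 by (intro mult_mono) auto
    then show ?thesis by (intro mult_right_mono) (auto simp del: of_nat_mult)
  qed
  also have "\<dots> = 6 * real T powr (- \<gamma>)"
  proof -
    have "exp (- b) = real T powr (- \<gamma> - 2)" using T by (simp add: powr_def b_def algebra_simps)
    also have "\<dots> = real T powr (- \<gamma>) / (real T * real T)"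
      using T by (simp add: powr_diff power2_eq_square)
    finally show ?thesis using T by simp
  qed
  finally show ?thesis .
qed

end

theorem theorem5p3:
  fixes \<gamma> c :: real
  assumes "\<gamma> > 0" and "c > 0"
  shows "\<exists>(C::real) (p::nat).
    \<forall>(k::nat) (Ts :: nat \<Rightarrow> nat) (T::nat) (n::nat) (m::nat) (l :: nat \<Rightarrow> nat \<Rightarrow> real)
      (fwd :: nat \<Rightarrow> nat \<Rightarrow> nat \<Rightarrow> nat \<Rightarrow> real) (smp :: nat \<Rightarrow> nat \<Rightarrow> nat \<Rightarrow> real).
      time_scales k Ts T \<longrightarrow>
      real T \<le> real n powr c \<longrightarrow> real n \<le> real T powr c \<longrightarrow>
      1 \<le> m \<longrightarrow> real m \<le> real T powr c \<longrightarrow>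
      (\<forall>t<T. \<forall>x<n. 0 \<le> l t x \<and> l t x \<le> 1) \<longrightarrow>
      arrival_scheme m fwd smp \<longrightarrow>
      measure_pmf.prob (hier_run k Ts n m fwd smp l T)
        {s. regret l T n (played s) \<le>
              C * ln (real T) ^ p *
              (real (Ts k) / real m + real (Ts k) / sqrt (real (Ts (k - 1)))
               + real n / real m * (\<Sum>i<k. real (Ts i) / sqrt (real (prev_scale Ts i))))}
        \<ge> 1 - C * real T powr (- \<gamma>)"
proof -
  define K where "K = 2 * sqrt (2 * c + 2) + \<gamma> + 10"
  \<comment> \<open>6 is for the union bound, \<open>4 * K\<close> turns \<open>2 * K * L\<close>
    into a multiple of \<open>L\<^sup>2\<close>, and the last summand is the rate times the number
    of bad times.\<close>
  define C where "C = 6 + 4 * K + 2 * K * (\<gamma> + 2)"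
  have K: "0 \<le> K" using assms by (simp add: K_def)
  have C: "6 \<le> C" "4 * K \<le> C" "2 * K * (\<gamma> + 2) \<le> C" using K assms by (simp_all add: C_def)
  have "1 - C * real T powr (- \<gamma>) \<le>
      measure_pmf.prob (hier_run k Ts n m fwd smp l T)
        {s. regret l T n (played s) \<le>
              C * ln (real T) ^ 2 *
              (real (Ts k) / real m + real (Ts k) / sqrt (real (Ts (k - 1)))
               + real n / real m * (\<Sum>i<k. real (Ts i) / sqrt (real (prev_scale Ts i))))}"
    if ts: "time_scales k Ts T" and Tn: "real T \<le> real n powr c" and m: "1 \<le> m" "real m \<le> real T powr c"
      and l: "\<forall>t<T. \<forall>x<n. 0 \<le> l t x \<and> l t x \<le> 1" and arr: "arrival_scheme m fwd smp"
    for k Ts T n m l fwd smp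
  proof -
    have "0 < T" using ts unfolding time_scales_def by (metis gr_zeroI less_nat_zero_code less_Suc_eq
          lift_Suc_mono_less not0_implies_Suc lessI)
    \<comment> \<open>For \<open>n = 0\<close> the bound would read
      \<open>T \<le> 0 powr c = 0\<close>.\<close>
    then have n: "0 < n" using Tn by (cases n) auto
    interpret hierarchy k Ts T n m l fwd smp
      using ts n m l arr by unfold_locales auto
    \<comment> \<open>The losses are fixed in advance, so the best expert is not random, and the
      exceptional sets of this single \<open>x\<close> suffice.\<close>
    have "Min ((\<lambda>x. \<Sum>t<T. l t x) ` {..<n}) \<in> (\<lambda>x. \<Sum>t<T. l t x) ` {..<n}"
      using n by (intro Min_in) auto
    then obtain x where x: "x < n" "Min ((\<lambda>x. \<Sum>t<T. l t x) ` {..<n}) = (\<Sum>t<T. l t x)" by auto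
    define L where "L = ln (real T)"
    have L: "1 / 2 \<le> L" using ln_T_ge by (simp add: L_def)
    define S where "S = (\<Sum>i<k. real (Ts i) / sqrt (real (prev_scale Ts i)))"
    have S: "0 \<le> S" unfolding S_def by (intro sum_nonneg) auto
    define bound where "bound = C * L ^ 2 * (real (Ts k) / real m + real (Ts k) / sqrt (real (Ts (k - 1)))
               + real n / real m * S)"
    define X where "X = (\<Union>(i, u)\<in>{..<k} \<times> {..T}. exceptional ((\<gamma> + 2) * ln (real T)) x i u)"
    have le: "regret l T n (played (st w T)) \<le> bound" if w: "w \<in> set_pmf (run_pmf T)" "w \<notin> X" for w
    proof -
      have "regret l T n (played (st w T)) = (\<Sum>d<T. l d (chosen w d (k - 1))) - (\<Sum>d<T. l d x)"
        unfolding regret_def played_st x(2) by simp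
      also have "\<dots> \<le> \<epsilon> * real T + 2 * (K * L) * (real T / sqrt (real (Ts (k - 1)))
          + real n * ((\<gamma> + 2) * L) / real m * S)"
        unfolding K_def L_def S_def
        using w(2) by (intro regret_le_unless_exceptional[OF w(1) x(1) m(2) assms(2,1)]) (auto simp: X_def)
      also have "\<dots> = L * (real T / real m) + (2 * K * L) * (real T / sqrt (real (Ts (k - 1))))
          + (2 * K * (\<gamma> + 2) * L\<^sup>2) * (real n / real m * S)"
        by (simp add: \<epsilon>_def L_def power2_eq_square algebra_simps add_divide_distrib flip: T_eq)
      also have "\<dots> \<le> (C * L\<^sup>2) * (real T / real m) + (C * L\<^sup>2) * (real T / sqrt (real (Ts (k - 1))))
          + (C * L\<^sup>2) * (real n / real m * S)"
      proof (intro add_mono mult_right_mono)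
        have L2: "L \<le> 2 * L\<^sup>2" using mult_right_mono[OF L, of L] L by (simp add: power2_eq_square)
        then show "L \<le> C * L\<^sup>2" using mult_right_mono[OF C(1), of "L\<^sup>2"] zero_le_power2[of L] by linarith
        have "2 * K * L \<le> 2 * K * (2 * L\<^sup>2)" using L2 K by (intro mult_left_mono) auto
        also have "\<dots> \<le> C * L\<^sup>2" using mult_right_mono[OF C(2), of "L\<^sup>2"] by simp
        finally show "2 * K * L \<le> C * L\<^sup>2" .
        show "2 * K * (\<gamma> + 2) \<le> C" by (rule C(3))
      qed (use S in auto)
      also have "\<dots> = bound" by (simp add: bound_def distrib_left T_eq)
      finally show ?thesis .
    qed
    have "1 - C * real T powr (- \<gamma>) \<le> 1 - 6 * real T powr (- \<gamma>)"
      using C(1) by (simp add: mult_right_mono)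
    also have "\<dots> \<le> 1 - measure_pmf.prob (run_pmf T) X"
      using prob_some_exceptional[OF x(1), of \<gamma>] by (simp add: X_def)
    also have "\<dots> = measure_pmf.prob (run_pmf T) (- X)"
      using measure_pmf.prob_compl[of X "run_pmf T"] by (simp add: Compl_eq_Diff_UNIV)
    also have "\<dots> \<le> measure_pmf.prob (run_pmf T) {w. regret l T n (played (st w T)) \<le> bound}"
      using le by (intro measure_pmf.finite_measure_mono_AE AE_pmfI) auto
    also have "\<dots> = measure_pmf.prob (hier_run k Ts n m fwd smp l T) {s. regret l T n (played s) \<le> bound}"
      unfolding hier_run_conv_run_pmf by (simp add: vimage_def)
    finally show ?thesis unfolding bound_def S_def L_def .
  qed
  then show ?thesis by (intro exI[of _ C] exI[of _ 2]) blast
qed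

end
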